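(* Let $\mathcal{E} = (X, P_{\theta} ; \theta \in \Theta)$ be an experiment such that for some $n \in \{1,2,\dotsc\}$, $\alpha > 0$, and $\beta > 0$ the family $(P_{\theta})_{\theta \in \Theta}$ is $(2n,\alpha,\beta)$-rich. Then $$\frac{\alpha \beta}{12\sqrt{2}}\,\frac{1}{\sqrt{n+1}} \leq \delta(\mathcal{E}^{\otimes n}, \mathcal{E}^{\otimes n+1}).$$
   Context: An experiment $\mathcal{E} = (X, P_{\theta} ; \theta \in \Theta)$ consists of a parameter set $\Theta$, a measurable space $X$ (the sample space) and a family $(P_\theta)_{\theta\in\Theta}$ of probability measures on $X$. For $n \in \{1,2,\dotsc\}$ its $n$-fold repetition is $\mathcal{E}^{\otimes n} = (X^{\otimes n}, P_\theta^{\otimes n} ; \theta\in\Theta)$, with $X^{\otimes n}$ the $n$-fold product measurable space and $P_\theta^{\otimes n}$ the $n$-fold product measure. A finite normalised decision problem on $\Theta$ is a pair $(A,L)$ with $A$ a finite set (with the discrete $\sigma$-algebra) and $L \colon A\times\Theta\to[0,1]$. A decision procedure for $(A,L)$ on observing $\mathcal{E}$ is a Markov kernel $\rho$ from $X$ to $A$, and its risk at $\theta$ is $R_{\mathcal{E}}(\rho,\theta)=\int\int L(a,\theta)\,\rho_x(da)\,P_\theta(dx)$. For two experiments $\mathcal{E}$ and $\mathcal{F}$ on the same parameter set $\Theta$ (with possibly different sample spaces $X$ and $Y$), the deficiency $\delta(\mathcal{E},\mathcal{F})$ is the smallest number (infimum) $\varepsilon\geq 0$ such that for every finite normalised decision problem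 $(A,L)$ on $\Theta$ and every decision procedure $\rho$ on $Y$ there exists a decision procedure $\rho'$ on $X$ with $R_{\mathcal{E}}(\rho',\theta)\leq R_{\mathcal{F}}(\rho,\theta)+\varepsilon$ for all $\theta\in\Theta$. $\|P-Q\| = \sup_A |P(A)-Q(A)|$ denotes total variation distance (half the $L^1$-distance of densities), and $\Delta_m=\{(x_1,\dotsc,x_m)\in[0,\infty)^m \mid x_1+\dotsb+x_m=1\}$. $(m,\alpha,\beta)$-richness: for $m\in\{1,2,\dotsc\}$, $\alpha\geq 0$, $\beta\geq 0$, a family $(P_\theta)_{\theta\in\Theta}$ of probability measures on $X$ is $(m,\alpha,\beta)$-rich if there exist a measurable partition $\{X_1,\dotsc,X_m\}$ of $X$; convex coefficients $(p_1,\dotsc,p_m)\in\Delta_m$ with $p_1,\dotsc,p_m\geq\beta/m$; and pairs of distinct probability measures $(Q_{1,0},Q_{1,1}),\dotsc,(Q_{m,0},Q_{m,1})$ supported on $X_1,\dotsc,X_m$, respectively, such that $\|Q_{j,0}-Q_{j,1}\|\geq\alpha$ for each $j$, and for every $(i_1,\dotsc,i_m)\in\{0,1\}^m$ there exists $\theta\in\Theta$ with $P_\theta=p_1Q_{1,i_1}+\dotsb+p_mQ_{m,i_m}$. *)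

theory Defs
  imports "HOL-Probability.Probability"
begin

definition is_experiment :: "'t set \<Rightarrow> 'a measure \<Rightarrow> ('t \<Rightarrow> 'a measure) \<Rightarrow> bool" where
  "is_experiment \<Theta> X P \<longleftrightarrow> (\<forall>\<theta>\<in>\<Theta>. P \<theta> \<in> space (prob_algebra X))"

definition rep_space :: "nat \<Rightarrow> 'a measure \<Rightarrow> (nat \<Rightarrow> 'a) measure" where
  "rep_space n X = Pi\<^sub>M {..<n} (\<lambda>_. X)"

definition rep_family :: "nat \<Rightarrow> ('t \<Rightarrow> 'a measure) \<Rightarrow> 't \<Rightarrow> (nat \<Rightarrow> 'a) measure" where
  "rep_family n P \<theta> = Pi\<^sub>M {..<n} (\<lambda>_. P \<theta>)"

text \<open>
  Action sets are finite sets of natural numbers: every finite set is in bijection with one of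
  these, and a bijection transports loss functions, decision procedures and risks.
\<close>

definition decision_problem :: "'t set \<Rightarrow> nat set \<Rightarrow> (nat \<Rightarrow> 't \<Rightarrow> real) \<Rightarrow> bool" where
  "decision_problem \<Theta> A L \<longleftrightarrow> finite A \<and> (\<forall>a\<in>A. \<forall>\<theta>\<in>\<Theta>. L a \<theta> \<in> {0..1})"

definition decision_procedures :: "'a measure \<Rightarrow> nat set \<Rightarrow> ('a \<Rightarrow> nat measure) set" where
  "decision_procedures X A = X \<rightarrow>\<^sub>M prob_algebra (count_space A)"

definition risk ::
  "('t \<Rightarrow> 'a measure) \<Rightarrow> (nat \<Rightarrow> 't \<Rightarrow> real) \<Rightarrow> ('a \<Rightarrow> nat measure) \<Rightarrow> 't \<Rightarrow> real" where
  "risk P L \<rho> \<theta> = (\<integral>x. (\<integral>a. L a \<theta> \<partial>\<rho> x) \<partial>P \<theta>)"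

definition deficient_by ::
  "'t set \<Rightarrow> 'a measure \<Rightarrow> ('t \<Rightarrow> 'a measure) \<Rightarrow> 'b measure \<Rightarrow> ('t \<Rightarrow> 'b measure) \<Rightarrow> real \<Rightarrow> bool" where
  "deficient_by \<Theta> X P Y Q \<epsilon> \<longleftrightarrow>
     (\<forall>A L. decision_problem \<Theta> A L \<longrightarrow>
       (\<forall>\<rho>\<in>decision_procedures Y A. \<exists>\<rho>'\<in>decision_procedures X A.
          \<forall>\<theta>\<in>\<Theta>. risk P L \<rho>' \<theta> \<le> risk Q L \<rho> \<theta> + \<epsilon>))"

definition deficiency ::
  "'t set \<Rightarrow> 'a measure \<Rightarrow> ('t \<Rightarrow> 'a measure) \<Rightarrow> 'b measure \<Rightarrow> ('t \<Rightarrow> 'b measure) \<Rightarrow> real" where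
  "deficiency \<Theta> X P Y Q = Inf {\<epsilon>. 0 \<le> \<epsilon> \<and> deficient_by \<Theta> X P Y Q \<epsilon>}"

text \<open>
  The infimum is taken over a set bounded below by \<open>0\<close>; the next lemmas show that the set contains
  \<open>1\<close> as soon as the parameter set is nonempty, so the infimum is a genuine one.
\<close>

lemma risk_bounds:
  assumes E: "is_experiment \<Theta> X P" and D: "decision_problem \<Theta> A L"
    and \<rho>: "\<rho> \<in> decision_procedures X A" and \<theta>: "\<theta> \<in> \<Theta>"
  shows "0 \<le> risk P L \<rho> \<theta>" and "risk P L \<rho> \<theta> \<le> 1"
proof -
  have P: "prob_space (P \<theta>)" and sP: "space (P \<theta>) = space X"
    using E \<theta> by (auto simp: is_experiment_def space_prob_algebra dest: sets_eq_imp_space_eq)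
  have inner: "0 \<le> (\<integral>a. L a \<theta> \<partial>\<rho> x) \<and> (\<integral>a. L a \<theta> \<partial>\<rho> x) \<le> 1" if "x \<in> space X" for x
  proof -
    have "\<rho> x \<in> space (prob_algebra (count_space A))"
      using \<rho> that unfolding decision_procedures_def by (rule measurable_space)
    then have pr: "prob_space (\<rho> x)" and sp: "space (\<rho> x) = A"
      using sets_eq_imp_space_eq[of "\<rho> x" "count_space A"] by (auto simp: space_prob_algebra)
    have L: "0 \<le> L a \<theta>" "L a \<theta> \<le> 1" if "a \<in> A" for a
      using D \<theta> that by (auto simp: decision_problem_def)
    show ?thesis
    proof
      show "0 \<le> (\<integral>a. L a \<theta> \<partial>\<rho> x)"
        by (rule Bochner_Integration.integral_nonneg) (use L sp in auto)
      show "(\<integral>a. L a \<theta> \<partial>\<rho> x) \<le> 1"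
      proof (cases "integrable (\<rho> x) (\<lambda>a. L a \<theta>)")
        case True
        then show ?thesis
          by (intro prob_space.integral_le_const[OF pr] AE_I2) (use L sp in auto)
      qed (simp add: not_integrable_integral_eq)
    qed
  qed
  show "0 \<le> risk P L \<rho> \<theta>"
    unfolding risk_def by (rule Bochner_Integration.integral_nonneg) (use inner sP in auto)
  show "risk P L \<rho> \<theta> \<le> 1"
  proof (cases "integrable (P \<theta>) (\<lambda>x. \<integral>a. L a \<theta> \<partial>\<rho> x)")
    case True
    then show ?thesis
      unfolding risk_def
      by (intro prob_space.integral_le_const[OF P] AE_I2) (use inner sP in auto)
  qed (simp add: risk_def not_integrable_integral_eq)
qed

lemma deficient_by_1:
  assumes E: "is_experiment \<Theta> X P" and F: "is_experiment \<Theta> Y Q" and ne: "\<Theta> \<noteq> {}"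
  shows "deficient_by \<Theta> X P Y Q 1"
  unfolding deficient_by_def
proof (intro allI impI ballI)
  fix A L \<rho>
  assume D: "decision_problem \<Theta> A L" and \<rho>: "\<rho> \<in> decision_procedures Y A"
  obtain \<theta>0 where "\<theta>0 \<in> \<Theta>" using ne by auto
  then have "prob_space (Q \<theta>0)" "space (Q \<theta>0) = space Y"
    using F by (auto simp: is_experiment_def space_prob_algebra dest: sets_eq_imp_space_eq)
  then obtain y where y: "y \<in> space Y"
    using prob_space.not_empty by blast
  have "\<rho> y \<in> space (prob_algebra (count_space A))"
    using \<rho> y unfolding decision_procedures_def by (rule measurable_space)
  then have \<rho>': "(\<lambda>_. \<rho> y) \<in> decision_procedures X A"
    unfolding decision_procedures_def by (rule measurable_const)
  have "risk P L (\<lambda>_. \<rho> y) \<theta> \<le> risk Q L \<rho> \<theta> + 1" if "\<theta> \<in> \<Theta>" for \<theta>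
    using risk_bounds(2)[OF E D \<rho>' that] risk_bounds(1)[OF F D \<rho> that] by linarith
  with \<rho>' show "\<exists>\<rho>'\<in>decision_procedures X A. \<forall>\<theta>\<in>\<Theta>. risk P L \<rho>' \<theta> \<le> risk Q L \<rho> \<theta> + 1"
    by blast
qed

text \<open>Only meaningful for probability measures on the same \<open>\<sigma>\<close>-algebra.\<close>

definition tv_dist :: "'a measure \<Rightarrow> 'a measure \<Rightarrow> real" where
  "tv_dist P Q = (SUP A\<in>sets P. \<bar>measure P A - measure Q A\<bar>)"

text \<open>
  The cells of the partition are automatically nonempty, since each of them carries a
  probability measure.
\<close>

definition rich :: "nat \<Rightarrow> real \<Rightarrow> real \<Rightarrow> 't set \<Rightarrow> 'a measure \<Rightarrow> ('t \<Rightarrow> 'a measure) \<Rightarrow> bool" where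
  "rich m \<alpha> \<beta> \<Theta> X P \<longleftrightarrow>
     (\<exists>(S :: nat \<Rightarrow> 'a set) (p :: nat \<Rightarrow> real) (Q :: nat \<Rightarrow> nat \<Rightarrow> 'a measure).
        (\<forall>j\<in>{1..m}. S j \<in> sets X) \<and> disjoint_family_on S {1..m} \<and> (\<Union>j\<in>{1..m}. S j) = space X \<and>
        (\<forall>j\<in>{1..m}. 0 \<le> p j) \<and> (\<Sum>j=1..m. p j) = 1 \<and> (\<forall>j\<in>{1..m}. \<beta> / real m \<le> p j) \<and>
        (\<forall>j\<in>{1..m}. \<forall>k\<in>{0, 1}. Q j k \<in> space (prob_algebra X) \<and> measure (Q j k) (S j) = 1) \<and>
        (\<forall>j\<in>{1..m}. Q j 0 \<noteq> Q j 1 \<and> \<alpha> \<le> tv_dist (Q j 0) (Q j 1)) \<and>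
        (\<forall>i\<in>{1..m} \<rightarrow> {0, 1}. \<exists>\<theta>\<in>\<Theta>. \<forall>B\<in>sets X.
           measure (P \<theta>) B = (\<Sum>j=1..m. p j * measure (Q j (i j)) B)))"

end

theory Submission
  imports Defs
begin

text \<open>
  Let \<open>m = 2 * n\<close> and put the uniform prior on the index \<open>i \<in> {0,1}\<^sup>m\<close>; the decision problem is to guess
  \<open>i\<close>, the guess being successful if at least \<open>t\<close> coordinates are correct. Given the data, the
  coordinates are independent under the posterior, so coordinatewise maximum likelihood is optimal
  for every \<open>t\<close> at once. At most \<open>n\<close> of the \<open>2 * n\<close> cells have been visited after \<open>n\<close> observations, so
  with probability at least \<open>\<beta>/2\<close> one more observation hits an unseen cell, where it raises the
  probability of a correct guess from \<open>1/2\<close> to at least \<open>1/2 + \<alpha>/2\<close>. This decides about success if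
  exactly \<open>t - 1\<close> of the other guesses are correct. Conditionally on the visited cells the number of
  correct guesses is a sum of independent indicators whose mean depends on each visited cell by at
  most \<open>1/2\<close>, so its variance is at most \<open>n/2 + n/4\<close>; an integer distribution of variance \<open>v\<close> has an
  atom of mass at least \<open>1 / sqrt (12 * v + 1)\<close>, and \<open>t\<close> is chosen to be pivotal at that atom.
\<close>

section \<open>Integer distributions with bounded atoms\<close>

text \<open>
  The antiderivative of the function \<open>y \<mapsto> max 0 (R\<^sup>2 - y\<^sup>2)\<close>, which is the extremal dual certificate for
  minimising a second moment under a bound on the density.
\<close>

definition clipped_cubic :: "real \<Rightarrow> real \<Rightarrow> real" where
  "clipped_cubic R y = (let z = max (-R) (min R y) in R\<^sup>2 * z - z ^ 3 / 3)"

text \<open>The increment is the integral of \<open>max 0 (R\<^sup>2 - y\<^sup>2)\<close> over the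
  unit interval centred at \<open>a\<close>. Without truncation this integral equals
  \<open>R\<^sup>2 - 1/12 - a\<^sup>2\<close>, and truncation only adds mass. Integration is
  avoided: the factorisation \<open>cubic\<close> of differences does all the work.\<close>

lemma clipped_cubic_increment:
  fixes R :: real
  assumes R: "R > 0"
  defines "H \<equiv> clipped_cubic R"
  shows "R\<^sup>2 - 1/12 - a\<^sup>2 \<le> H (a + 1/2) - H (a - 1/2)" "0 \<le> H (a + 1/2) - H (a - 1/2)"
    "H y - H z \<le> 4/3 * R ^ 3"
proof -
  define G where "G = (\<lambda>y. R\<^sup>2 * y - y ^ 3 / 3)"
  have cubic: "G v - G u = (v - u) * (R\<^sup>2 - (u\<^sup>2 + u * v + v\<^sup>2) / 3)" for u v
    by (simp add: G_def field_simps power2_eq_square power3_eq_cube)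
  have mono: "G u \<le> G v" if "-R \<le> u" "u \<le> v" "v \<le> R" for u v
  proof -
    have "u\<^sup>2 \<le> R\<^sup>2" "v\<^sup>2 \<le> R\<^sup>2"
      using that by (auto simp: abs_le_square_iff[symmetric])
    moreover have "2 * (u * v) \<le> u\<^sup>2 + v\<^sup>2"
      using sum_squares_bound[of u v] by simp
    ultimately have "0 \<le> R\<^sup>2 - (u\<^sup>2 + u * v + v\<^sup>2) / 3" by simp
    then show ?thesis
      using cubic[of v u] that mult_nonneg_nonneg[of "v - u" "R\<^sup>2 - (u\<^sup>2 + u * v + v\<^sup>2) / 3"] by linarith
  qed
  have H: "H y = G (max (-R) (min R y))" for y
    by (simp add: H_def clipped_cubic_def G_def Let_def)
  have Hmono: "H y \<le> H z" if "y \<le> z" for y z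
    unfolding H by (rule mono) (use that R in auto)
  then show pos: "0 \<le> H (a + 1/2) - H (a - 1/2)" by simp
  have "H y \<le> G R" "G (-R) \<le> H z"
    unfolding H by (rule mono; use R in auto)+
  then show "H y - H z \<le> 4/3 * R ^ 3"
    by (simp add: G_def power2_eq_square power3_eq_cube)
  \<comment> \<open>Between \<open>-R\<close> and \<open>R\<close> the two functions agree; beyond
    \<open>R\<close> the cubic falls while \<open>H\<close> stays at \<open>G R\<close>.\<close>
  have up: "G y \<le> H y" if "-R \<le> y" for y
  proof (cases "y \<le> R")
    case False
    have "R\<^sup>2 \<le> y\<^sup>2" "R\<^sup>2 \<le> R * y" using R False by (auto simp: power2_eq_square mult_mono)
    then have "R\<^sup>2 - (R\<^sup>2 + R * y + y\<^sup>2) / 3 \<le> 0" by simp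
    then have "G y \<le> G R"
      using cubic[where v = y and u = R] False mult_nonneg_nonpos[of "y - R" "R\<^sup>2 - (R\<^sup>2 + R * y + y\<^sup>2) / 3"]
      by linarith
    then show ?thesis using False R by (simp add: H)
  qed (use that in \<open>simp add: H\<close>)
  have odd: "H (-y) = - H y" "G (-y) = - G y" for y
  proof -
    have "max (-R) (min R (-y)) = - max (-R) (min R y)"
      using R by (auto simp: max_def min_def)
    then show "H (-y) = - H y" by (simp add: H G_def)
  qed (simp add: G_def)
  have low: "H y \<le> G y" if "y \<le> R" for y
    using up[of "-y"] that by (simp add: odd)
  \<comment> \<open>In the first case the right endpoint is at least \<open>-R\<close> and the left
    one at most \<open>R\<close>, so \<open>up\<close> and \<open>low\<close> apply. Farther out the
    left side is negative and monotonicity suffices.\<close>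
  show "R\<^sup>2 - 1/12 - a\<^sup>2 \<le> H (a + 1/2) - H (a - 1/2)"
  proof (cases "\<bar>a\<bar> \<le> R + 1/2")
    case True
    have "R\<^sup>2 - 1/12 - a\<^sup>2 = G (a + 1/2) - G (a - 1/2)"
      unfolding cubic by (simp add: field_simps power2_eq_square)
    also have "\<dots> \<le> H (a + 1/2) - H (a - 1/2)"
      by (intro diff_mono up low) (use True in auto)
    finally show ?thesis .
  next
    case False
    then have "R\<^sup>2 \<le> a\<^sup>2" using R by (auto simp: abs_le_square_iff[symmetric])
    with pos show ?thesis by simp
  qed
qed

text \<open>Weak duality: the increments of \<open>clipped_cubic\<close> are nonnegative and
  dominate the coefficients \<open>R\<^sup>2 - 1/12 - (s - c)\<^sup>2\<close>, so every weight may
  be raised to \<tau>, and consecutive increments telescope. The radius \<open>R\<close> stays free,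
  to be optimised once mass and second moment are known.\<close>

lemma bounded_weights_second_moment:
  fixes T :: "nat \<Rightarrow> real"
  assumes T: "\<And>s. s < m \<Longrightarrow> 0 \<le> T s \<and> T s \<le> \<tau>" and R: "R > 0" and \<tau>: "0 \<le> \<tau>"
  shows "(R\<^sup>2 - 1/12) * (\<Sum>s<m. T s) - 4/3 * R ^ 3 * \<tau> \<le> (\<Sum>s<m. T s * (real s - c)\<^sup>2)"
proof -
  define H where "H = clipped_cubic R"
  note cc = clipped_cubic_increment[OF R, folded H_def]
  have "T s * (R\<^sup>2 - 1/12 - (real s - c)\<^sup>2) \<le> \<tau> * (H (real s - c + 1/2) - H (real s - c - 1/2))"
    if "s < m" for s
    using T[OF that] cc(1,2)[of "real s - c"]
    by (meson mult_left_mono mult_right_mono order_trans)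
  then have "(\<Sum>s<m. T s * (R\<^sup>2 - 1/12 - (real s - c)\<^sup>2))
      \<le> (\<Sum>s<m. \<tau> * (H (real s - c + 1/2) - H (real s - c - 1/2)))"
    by (intro sum_mono) auto
  also have "\<dots> = \<tau> * (\<Sum>s<m. H (real (Suc s) - c - 1/2) - H (real s - c - 1/2))"
    by (simp add: sum_distrib_left algebra_simps)
  also have "\<dots> = \<tau> * (H (real m - c - 1/2) - H (real 0 - c - 1/2))"
    by (subst sum_lessThan_telescope) simp
  also have "\<dots> \<le> \<tau> * (4/3 * R ^ 3)"
    by (intro mult_left_mono cc(3) \<tau>)
  also have "(\<Sum>s<m. T s * (R\<^sup>2 - 1/12 - (real s - c)\<^sup>2))
      = (R\<^sup>2 - 1/12) * (\<Sum>s<m. T s) - (\<Sum>s<m. T s * (real s - c)\<^sup>2)"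
    by (simp only: right_diff_distrib[of _ _ "(real _ - c)\<^sup>2"] sum_subtractf
        sum_distrib_right[symmetric] mult.commute)
  finally show ?thesis by (simp add: mult_ac)
qed

section \<open>Numbers of correct guesses and of visits to the cells\<close>

text \<open>
  The integral of \<open>f\<close> over the number of successes of independent trials with success weights \<open>x j\<close> and
  failure weights \<open>y j\<close>; the weights are not normalised, since they will be likelihoods.
\<close>

definition pbsum :: "'j set \<Rightarrow> ('j \<Rightarrow> real) \<Rightarrow> ('j \<Rightarrow> real) \<Rightarrow> (nat \<Rightarrow> real) \<Rightarrow> real" where
  "pbsum J x y f = (\<Sum>C\<in>Pow J. (\<Prod>j\<in>C. x j) * (\<Prod>j\<in>J - C. y j) * f (card C))"

lemma pbsum_empty [simp]: "pbsum {} x y f = f 0"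
  by (simp add: pbsum_def)

lemma pbsum_prod_if:
  assumes "finite J"
  shows "pbsum J x y f = (\<Sum>C\<in>Pow J. (\<Prod>j\<in>J. if j \<in> C then x j else y j) * f (card C))"
  unfolding pbsum_def using assms
  by (intro sum.cong refl) (simp add: prod.If_cases Int_absorb1 Diff_eq Collect_mem_eq)

lemma pbsum_insert:
  assumes "finite J" "j \<notin> J"
  shows "pbsum (insert j J) x y f = x j * pbsum J x y (\<lambda>k. f (Suc k)) + y j * pbsum J x y f"
proof -
  let ?g = "\<lambda>C. (\<Prod>j\<in>C. x j) * (\<Prod>j\<in>insert j J - C. y j) * f (card C)"
  have "pbsum (insert j J) x y f = sum ?g (Pow J) + sum ?g (insert j ` Pow J)"
    unfolding pbsum_def Pow_insert using assms by (intro sum.union_disjoint) auto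
  also have "sum ?g (Pow J) = y j * pbsum J x y f"
    unfolding pbsum_def sum_distrib_left
  proof (rule sum.cong[OF refl])
    fix C assume "C \<in> Pow J"
    then have "insert j J - C = insert j (J - C)" "j \<notin> J - C" "finite (J - C)"
      using assms by auto
    then show "?g C = y j * ((\<Prod>j\<in>C. x j) * (\<Prod>j\<in>J - C. y j) * f (card C))"
      by simp
  qed
  also have "sum ?g (insert j ` Pow J) = (\<Sum>C\<in>Pow J. ?g (insert j C))"
    using assms by (subst sum.reindex) (auto simp: inj_on_def)
  also have "\<dots> = x j * pbsum J x y (\<lambda>k. f (Suc k))"
    unfolding pbsum_def sum_distrib_left
  proof (rule sum.cong[OF refl])
    fix C assume "C \<in> Pow J"
    then have "insert j J - insert j C = J - C" "j \<notin> C" "finite C"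
      using assms finite_subset by auto
    then show "?g (insert j C) = x j * ((\<Prod>j\<in>C. x j) * (\<Prod>j\<in>J - C. y j) * f (Suc (card C)))"
      by simp
  qed
  finally show ?thesis by simp
qed

lemma pbsum_remove:
  assumes "finite J" "j \<in> J"
  shows "pbsum J x y f
    = x j * pbsum (J - {j}) x y (\<lambda>k. f (Suc k)) + y j * pbsum (J - {j}) x y f"
  using pbsum_insert[of "J - {j}" j x y f] assms by (simp add: insert_absorb)

lemma pbsum_cong:
  "(\<And>j. j \<in> J \<Longrightarrow> x j = x' j) \<Longrightarrow> (\<And>j. j \<in> J \<Longrightarrow> y j = y' j) \<Longrightarrow> pbsum J x y f = pbsum J x' y' f"
  unfolding pbsum_def
  by (intro sum.cong refl arg_cong2[where f = "(*)"] prod.cong) auto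

lemma pbsum_mono:
  assumes "\<And>j. j \<in> J \<Longrightarrow> 0 \<le> x j \<and> 0 \<le> y j" "\<And>k. f k \<le> g k"
  shows "pbsum J x y f \<le> pbsum J x y g"
  unfolding pbsum_def
  by (intro sum_mono mult_left_mono assms mult_nonneg_nonneg prod_nonneg) (use assms in auto)

text \<open>Moving weight from failure to success at a fixed total favours every increasing function
  of the number of successes. This is why the coordinatewise maximum likelihood guess is optimal for
  all thresholds at once.\<close>

lemma pbsum_mono_weights:
  assumes "finite J" "mono f"
    and "\<And>j. j \<in> J \<Longrightarrow> 0 \<le> x j \<and> x j \<le> x' j \<and> 0 \<le> y' j \<and> x j + y j = x' j + y' j"
  shows "pbsum J x y f \<le> pbsum J x' y' f"
  using assms
proof (induction J arbitrary: f)
  case (insert j J)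
  have ij: "0 \<le> x j" "x j \<le> x' j" "0 \<le> y' j" "x j + y j = x' j + y' j"
    using insert.prems(2)[of j] by auto
  then have y: "0 \<le> y j" by linarith
  let ?B = "pbsum J x' y' f" and ?A = "pbsum J x' y' (\<lambda>k. f (Suc k))"
  have AB: "?B \<le> ?A"
  proof (rule pbsum_mono)
    show "0 \<le> x' i \<and> 0 \<le> y' i" if "i \<in> J" for i
      using insert.prems(2)[of i] that by auto
    show "f k \<le> f (Suc k)" for k
      using insert.prems(1) by (auto simp: mono_def)
  qed
  have "mono (\<lambda>k. f (Suc k))"
    using insert.prems(1) by (auto simp: mono_def)
  then have "pbsum J x y (\<lambda>k. f (Suc k)) \<le> ?A" "pbsum J x y f \<le> ?B"
    using insert.IH insert.prems by auto
  then have "pbsum (insert j J) x y f \<le> x j * ?A + y j * ?B"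
    using insert.hyps ij y by (simp add: pbsum_insert add_mono mult_left_mono)
  also have "\<dots> \<le> x' j * ?A + y' j * ?B"
  proof -
    have "(x' j - x j) * ?B \<le> (x' j - x j) * ?A"
      using AB ij by (intro mult_left_mono) auto
    moreover have "y j = y' j + (x' j - x j)" using ij by simp
    then have "y j * ?B = y' j * ?B + (x' j - x j) * ?B" by (simp add: distrib_right)
    ultimately show ?thesis by (simp add: left_diff_distrib)
  qed
  finally show ?case using insert.hyps by (simp add: pbsum_insert)
qed simp

lemma pbsum_add: "pbsum J x y (\<lambda>k. f k + g k) = pbsum J x y f + pbsum J x y g"
  by (simp add: pbsum_def distrib_left sum.distrib)

lemma pbsum_sum: "pbsum J x y (\<lambda>k. \<Sum>s\<in>S. a s * f s k) = (\<Sum>s\<in>S. a s * pbsum J x y (f s))"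
  unfolding pbsum_def sum_distrib_left
  by (subst sum.swap) (simp add: mult_ac sum_distrib_left)

text \<open>Squared bias plus variance of a sum of independent indicators. The centre is arbitrary
  in the induction because a success shifts it by one.\<close>

lemma pbsum_second_moment:
  assumes "finite J"
  shows "pbsum J x (\<lambda>j. 1 - x j) (\<lambda>k. (real k - a)\<^sup>2) = (sum x J - a)\<^sup>2 + (\<Sum>j\<in>J. x j * (1 - x j))"
  using assms
proof (induction J arbitrary: a)
  case (insert j J)
  have "pbsum J x (\<lambda>j. 1 - x j) (\<lambda>k. (real (Suc k) - a)\<^sup>2)
      = (sum x J - (a - 1))\<^sup>2 + (\<Sum>j\<in>J. x j * (1 - x j))"
    using insert.IH[of "a - 1"] by (simp add: algebra_simps)
  then show ?case
    using insert by (simp add: pbsum_insert) (simp add: power2_eq_square algebra_simps)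
qed (simp add: power2_eq_square)

lemma pbsum_const:
  assumes "finite J"
  shows "pbsum J x (\<lambda>j. 1 - x j) (\<lambda>_. c) = c"
  using assms by (induction J) (auto simp: pbsum_insert algebra_simps)

lemma pbsum_on:
  assumes "finite J" "\<And>k. k \<le> card J \<Longrightarrow> f k = g k"
  shows "pbsum J x y f = pbsum J x y g"
  unfolding pbsum_def using assms by (intro sum.cong refl) (auto simp: card_mono)

text \<open>
  The iterate \<open>draw J p ^^ n\<close> is the expectation over the cell counts after \<open>n\<close> further draws.
\<close>

definition draw :: "'j set \<Rightarrow> ('j \<Rightarrow> real) \<Rightarrow> (('j \<Rightarrow> nat) \<Rightarrow> real) \<Rightarrow> ('j \<Rightarrow> nat) \<Rightarrow> real" where
  "draw J p f N = (\<Sum>j\<in>J. p j * f (N(j := Suc (N j))))"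

section \<open>Averages and variances over multinomial cell counts\<close>

locale cell_weights =
  fixes J :: "'j set" and p :: "'j \<Rightarrow> real"
  assumes fin: "finite J" and p_nonneg: "\<And>j. j \<in> J \<Longrightarrow> 0 \<le> p j" and p_sum: "sum p J = 1"
begin

abbreviation E where "E n \<equiv> draw J p ^^ n"

lemma E_Suc: "E (Suc n) f N = (\<Sum>j\<in>J. p j * E n f (N(j := Suc (N j))))"
  by (simp add: draw_def)

text \<open>The last draw is split off here, whereas \<open>E_Suc\<close> conditions on the first
  one; this form compares \<open>n + 1\<close> observations with \<open>n\<close>.\<close>

lemma E_Suc': "E (Suc n) f = E n (draw J p f)"
  by (simp add: funpow_swap1)

text \<open>Only counts with the right total are reachable. The pointwise bound behind
  \<open>pivot_mass\<close> holds for such counts only.\<close>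

lemma E_mono_on:
  assumes "\<And>M. sum M J = sum N J + n \<Longrightarrow> f M \<le> g M"
  shows "E n f N \<le> E n g N"
  using assms
proof (induction n arbitrary: N)
  case (Suc n)
  show ?case unfolding E_Suc
  proof (intro sum_mono mult_left_mono p_nonneg Suc.IH Suc.prems)
    fix j M assume j: "j \<in> J" and "sum M J = sum (N(j := Suc (N j))) J + n"
    moreover have "sum (N(j := Suc (N j))) J = Suc (sum N J)"
      using fin j by (simp add: sum.remove[of J j])
    ultimately show "sum M J = sum N J + Suc n" by simp
  qed
qed simp

lemma E_mono: "(\<And>M. f M \<le> g M) \<Longrightarrow> E n f N \<le> E n g N"
  by (rule E_mono_on)

lemma E_const [simp]: "E n (\<lambda>_. c) N = c"
  by (induction n arbitrary: N) (simp_all add: draw_def sum_distrib_right[symmetric] p_sum)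

lemma E_add: "E n (\<lambda>M. f M + g M) N = E n f N + E n g N"
  by (induction n arbitrary: N) (simp_all add: draw_def sum.distrib algebra_simps)

lemma E_cmult: "E n (\<lambda>M. c * f M) N = c * E n f N"
  by (induction n arbitrary: N) (simp_all add: draw_def sum_distrib_left algebra_simps)

lemma E_sum: "E n (\<lambda>M. \<Sum>s\<in>S. f s M) N = (\<Sum>s\<in>S. E n (f s) N)"
proof (induction S rule: infinite_finite_induct)
  case (insert s S)
  then show ?case by (simp add: E_add)
qed simp_all

text \<open>Draws commute, so an exchange of cell \<open>j\<close> for cell \<open>k\<close> at the
  start can be postponed until after the \<open>n\<close> draws, where the hypothesis on
  \<open>f\<close> applies.\<close>

lemma E_shift_diff:
  assumes d: "\<And>M j k. j \<in> J \<Longrightarrow> k \<in> J \<Longrightarrow> f (M(j := Suc (M j))) \<le> f (M(k := Suc (M k))) + d"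
    and "j \<in> J" "k \<in> J"
  shows "E n f (N(j := Suc (N j))) \<le> E n f (N(k := Suc (N k))) + d"
proof (induction n arbitrary: N)
  case (Suc n)
  have comm: "N(j := Suc (N j), i := Suc ((N(j := Suc (N j))) i))
      = N(i := Suc (N i), j := Suc ((N(i := Suc (N i))) j))" for i j
    by (auto simp: fun_eq_iff)
  have "E (Suc n) f (N(j := Suc (N j)))
     \<le> (\<Sum>i\<in>J. p i * (E n f (N(k := Suc (N k), i := Suc ((N(k := Suc (N k))) i))) + d))"
    unfolding E_Suc by (intro sum_mono mult_left_mono p_nonneg) (subst (1 2) comm, rule Suc)
  also have "\<dots> = E (Suc n) f (N(k := Suc (N k))) + d"
    unfolding E_Suc by (simp add: sum.distrib distrib_left sum_distrib_right[symmetric] p_sum)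
  finally show ?case .
qed (use assms in auto)

text \<open>Martingale argument, conditioning on the first draw. By \<open>E_shift_diff\<close> the
  conditional means \<open>\<mu>' j\<close> differ from their average by at most \<open>d\<close>,
  which adds \<open>d\<^sup>2\<close>; the later draws are covered by the induction
  hypothesis.\<close>

lemma E_variance:
  assumes d: "\<And>M j k. j \<in> J \<Longrightarrow> k \<in> J \<Longrightarrow> f (M(j := Suc (M j))) \<le> f (M(k := Suc (M k))) + d"
  shows "E n (\<lambda>M. (f M - E n f N)\<^sup>2) N \<le> real n * d\<^sup>2"
proof (induction n arbitrary: N)
  case (Suc n)
  define \<mu> where "\<mu> = E (Suc n) f N"
  define \<mu>' where "\<mu>' j = E n f (N(j := Suc (N j)))" for j
  have \<mu>: "\<mu> = (\<Sum>j\<in>J. p j * \<mu>' j)" by (simp only: \<mu>_def E_Suc \<mu>'_def)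
  have step: "E n (\<lambda>M. (f M - \<mu>)\<^sup>2) (N(j := Suc (N j))) \<le> real n * d\<^sup>2 + d\<^sup>2" if j: "j \<in> J" for j
  proof -
    let ?N = "N(j := Suc (N j))"
    \<comment> \<open>Expansion about the conditional mean: the cross term averages to zero because
      \<open>E n f ?N\<close> is \<open>\<mu>' j\<close>.\<close>
    have "(f M - \<mu>)\<^sup>2 = (f M - \<mu>' j)\<^sup>2 + (2 * (\<mu>' j - \<mu>) * f M + ((\<mu>' j - \<mu>)\<^sup>2 - 2 * (\<mu>' j - \<mu>) * \<mu>' j))" for M
      by (simp add: power2_eq_square algebra_simps)
    then have "E n (\<lambda>M. (f M - \<mu>)\<^sup>2) ?N = E n (\<lambda>M. (f M - \<mu>' j)\<^sup>2) ?N + (\<mu>' j - \<mu>)\<^sup>2"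
      by (simp add: E_add E_cmult) (simp add: \<mu>'_def)
    moreover have "E n (\<lambda>M. (f M - \<mu>' j)\<^sup>2) ?N \<le> real n * d\<^sup>2"
      using Suc[of ?N] by (simp only: \<mu>'_def)
    moreover have "\<bar>\<mu>' j - \<mu>\<bar> \<le> d"
    proof -
      have ub: "\<mu>' j \<le> \<mu>' k + d" "\<mu>' k \<le> \<mu>' j + d" if "k \<in> J" for k
        unfolding \<mu>'_def by (rule E_shift_diff; use d j that in auto)+
      have "(\<Sum>k\<in>J. p k * (\<mu>' j - d)) \<le> \<mu>" "\<mu> \<le> (\<Sum>k\<in>J. p k * (\<mu>' j + d))"
        unfolding \<mu> using ub by (intro sum_mono mult_left_mono p_nonneg; force simp: algebra_simps)+
      then show ?thesis by (simp add: sum_distrib_right[symmetric] p_sum abs_le_iff)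
    qed
    then have "(\<mu>' j - \<mu>)\<^sup>2 \<le> d\<^sup>2"
      by (simp add: abs_le_square_iff[symmetric])
    ultimately show ?thesis by simp
  qed
  have "E (Suc n) (\<lambda>M. (f M - \<mu>)\<^sup>2) N \<le> (\<Sum>j\<in>J. p j * (real n * d\<^sup>2 + d\<^sup>2))"
    unfolding E_Suc by (intro sum_mono mult_left_mono p_nonneg step)
  also have "\<dots> = real (Suc n) * d\<^sup>2"
    by (simp add: sum_distrib_right[symmetric] p_sum) (simp add: algebra_simps)
  finally show ?case by (simp only: \<mu>_def)
qed simp

end

text \<open>Abstracts from the likelihoods: \<open>q j k\<close> plays the probability that
  coordinate \<open>j\<close> is guessed correctly after \<open>k\<close> visits to its cell. An
  unseen cell leaves a fair coin, and the first visit gains at least \<alpha>/2.\<close>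

locale cell_posteriors = cell_weights J p for J :: "'j set" and p +
  fixes q :: "'j \<Rightarrow> nat \<Rightarrow> real" and b \<alpha> :: real
  assumes q_bounds: "\<And>j k. j \<in> J \<Longrightarrow> 1/2 \<le> q j k \<and> q j k \<le> 1"
    and q_mono: "\<And>j k. j \<in> J \<Longrightarrow> q j k \<le> q j (Suc k)"
    and q_0: "\<And>j. j \<in> J \<Longrightarrow> q j 0 = 1/2"
    and q_1: "\<And>j. j \<in> J \<Longrightarrow> 1/2 + \<alpha>/2 \<le> q j 1"
    and p_ge: "\<And>j. j \<in> J \<Longrightarrow> b \<le> p j"
    and b_pos: "0 < b" and \<alpha>_pos: "0 < \<alpha>"
begin

section \<open>Pivotal guesses at unseen cells\<close>

abbreviation unseen where "unseen N \<equiv> {j\<in>J. N j = 0}"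

definition correct :: "'j set \<Rightarrow> ('j \<Rightarrow> nat) \<Rightarrow> (nat \<Rightarrow> real) \<Rightarrow> real" where
  "correct I N = pbsum I (\<lambda>j. q j (N j)) (\<lambda>j. 1 - q j (N j))"

lemma correct_nonneg: "(\<And>k. 0 \<le> f k) \<Longrightarrow> I \<subseteq> J \<Longrightarrow> 0 \<le> correct I N f"
  unfolding correct_def pbsum_def
  by (intro sum_nonneg mult_nonneg_nonneg prod_nonneg)
     (use q_bounds in \<open>auto intro: order_trans[of 0 "1/2"] simp: subset_iff\<close>)

text \<open>The extra observation alters only the guess of coordinate \<open>j\<close>, which
  decides whether the threshold is reached exactly when \<open>s\<close> of the other guesses are
  correct.\<close>

lemma correct_diff:
  assumes j: "j \<in> J"
  shows "correct J (N(j := Suc (N j))) (\<lambda>k. of_bool (Suc s \<le> k)) - correct J N (\<lambda>k. of_bool (Suc s \<le> k))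
    = (q j (Suc (N j)) - q j (N j)) * correct (J - {j}) N (\<lambda>k. of_bool (k = s))"
proof -
  let ?x = "\<lambda>j. q j (N j)" and ?y = "\<lambda>j. 1 - q j (N j)"
  let ?x' = "\<lambda>i. q i ((N(j := Suc (N j))) i)" and ?y' = "\<lambda>i. 1 - q i ((N(j := Suc (N j))) i)"
  have rest: "pbsum (J - {j}) ?x' ?y' f = pbsum (J - {j}) ?x ?y f" for f
    by (rule pbsum_cong) auto
  have split: "(\<lambda>k. of_bool (Suc s \<le> Suc k) :: real) = (\<lambda>k. of_bool (Suc s \<le> k) + of_bool (k = s))"
    by (auto simp: fun_eq_iff of_bool_def)
  show ?thesis
    unfolding correct_def pbsum_remove[OF fin j] rest unfolding split pbsum_add
    by (simp add: algebra_simps)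
qed

text \<open>Only draws of unseen cells are kept: each has probability at least \<open>b\<close> and
  improves its guess by at least \<alpha>/2. All other draws do no harm by
  \<open>q_mono\<close>.\<close>

lemma draw_gain:
  "b * (\<alpha>/2) * (\<Sum>j\<in>unseen N. correct (J - {j}) N (\<lambda>k. of_bool (k = s)))
    \<le> draw J p (\<lambda>N. correct J N (\<lambda>k. of_bool (Suc s \<le> k))) N - correct J N (\<lambda>k. of_bool (Suc s \<le> k))"
proof -
  let ?c = "\<lambda>j. correct (J - {j}) N (\<lambda>k. of_bool (k = s))"
  have c: "0 \<le> ?c j" for j by (rule correct_nonneg) auto
  have "b * (\<alpha>/2) * (\<Sum>j\<in>unseen N. ?c j) = (\<Sum>j\<in>unseen N. b * ((\<alpha>/2) * ?c j))"
    by (simp add: sum_distrib_left mult_ac)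
  also have "\<dots> \<le> (\<Sum>j\<in>unseen N. p j * ((q j (Suc (N j)) - q j (N j)) * ?c j))"
  proof (rule sum_mono)
    fix j assume "j \<in> unseen N"
    then have j: "j \<in> J" "N j = 0" by auto
    then have "\<alpha>/2 \<le> q j (Suc (N j)) - q j (N j)" using q_0[of j] q_1[of j] by simp
    then show "b * ((\<alpha>/2) * ?c j) \<le> p j * ((q j (Suc (N j)) - q j (N j)) * ?c j)"
      using p_ge[OF j(1)] p_nonneg[OF j(1)] \<alpha>_pos c[of j] by (intro mult_mono mult_right_mono) auto
  qed
  also have "\<dots> \<le> (\<Sum>j\<in>J. p j * ((q j (Suc (N j)) - q j (N j)) * ?c j))"
    using fin p_nonneg q_mono c by (intro sum_mono2) auto
  also have "\<dots> = draw J p (\<lambda>N. correct J N (\<lambda>k. of_bool (Suc s \<le> k))) N - correct J N (\<lambda>k. of_bool (Suc s \<le> k))"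
    by (simp add: correct_diff[symmetric] draw_def right_diff_distrib sum_subtractf
        sum_distrib_right[symmetric] p_sum)
  finally show ?thesis .
qed

text \<open>As a measure in \<open>s\<close> this is not normalised: its total mass is the expected
  number of unseen cells.\<close>

definition pivot :: "nat \<Rightarrow> nat \<Rightarrow> real" where
  "pivot n s = E n (\<lambda>N. \<Sum>j\<in>unseen N. correct (J - {j}) N (\<lambda>k. of_bool (k = s))) (\<lambda>_. 0)"

text \<open>With coordinate \<open>j\<close> removed there are fewer than \<open>card J\<close>
  correct guesses, so the range of \<open>s\<close> exhausts their distribution.\<close>

lemma pivot_moment:
  "(\<Sum>s<card J. pivot n s * f s)
    = E n (\<lambda>N. \<Sum>j\<in>unseen N. correct (J - {j}) N f) (\<lambda>_. 0)"
proof -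
  have "correct (J - {j}) N f = (\<Sum>s<card J. f s * correct (J - {j}) N (\<lambda>k. of_bool (k = s)))"
    if "j \<in> J" for N j
  proof -
    have "f k = (\<Sum>s<card J. f s * of_bool (k = s))" if "k \<le> card (J - {j})" for k
proof -
      have "k < card J"
        using that \<open>j \<in> J\<close> card_Diff1_less[OF fin] by force
      moreover have "(\<Sum>s<card J. f s * of_bool (k = s)) = (\<Sum>s<card J. if k = s then f s else 0)"
        by (intro sum.cong) auto
      ultimately show ?thesis by simp
    qed
    then have "correct (J - {j}) N f = correct (J - {j}) N (\<lambda>k. \<Sum>s<card J. f s * of_bool (k = s))"
      unfolding correct_def by (rule pbsum_on[OF finite_Diff[OF fin]])
    then show ?thesis by (simp only: correct_def pbsum_sum)
  qed
  then have "(\<lambda>N. \<Sum>j\<in>unseen N. correct (J - {j}) N f)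
      = (\<lambda>N. \<Sum>s<card J. f s * (\<Sum>j\<in>unseen N. correct (J - {j}) N (\<lambda>k. of_bool (k = s))))"
    by (auto simp: fun_eq_iff sum_distrib_left intro!: trans[OF _ sum.swap] sum.cong)
  then show ?thesis
    by (simp add: pivot_def E_sum E_cmult mult.commute)
qed

text \<open>At most \<open>n\<close> of the \<open>2 * n\<close> cells are visited by
  \<open>n\<close> draws, and every unseen cell contributes mass one.\<close>

lemma pivot_mass:
  assumes "card J = 2 * n"
  shows "real n \<le> (\<Sum>s<card J. pivot n s)"
proof -
  have "real n \<le> (\<Sum>j\<in>unseen M. correct (J - {j}) M (\<lambda>_. 1))"
    if "sum M J = sum (\<lambda>_. 0) J + n" for M
  proof -
    have "card (J - unseen M) = (\<Sum>j\<in>J - unseen M. 1)" by simp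
    also have "\<dots> \<le> (\<Sum>j\<in>J - unseen M. M j)" by (rule sum_mono) auto
    also have "\<dots> \<le> (\<Sum>j\<in>J. M j)" by (rule sum_mono2) (use fin in auto)
    finally have "card (J - unseen M) \<le> n" using that by simp
    then have "n \<le> card (unseen M)"
      using assms fin by (simp add: card_Diff_subset)
    then show ?thesis
      using fin by (simp add: correct_def pbsum_const)
  qed
  then have "E n (\<lambda>_. real n) (\<lambda>_. 0) \<le> E n (\<lambda>N. \<Sum>j\<in>unseen N. correct (J - {j}) N (\<lambda>_. 1)) (\<lambda>_. 0)"
    by (rule E_mono_on)
  then show ?thesis
    using pivot_moment[of n "\<lambda>_. 1"] by (simp only: mult_1_right E_const)
qed

text \<open>Given the counts, the other guesses have variance at most \<open>n / 2\<close>, each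
  indicator contributing at most 1/4; their mean varies with the counts, with variance at most
  \<open>n / 4\<close> by \<open>E_variance\<close>. Both are multiplied by \<open>2 * n\<close>,
  the number of all cells, as a bound for the number of unseen ones.\<close>

lemma pivot_second_moment:
  assumes card: "card J = 2 * n"
  shows "\<exists>c. (\<Sum>s<card J. pivot n s * (real s - c)\<^sup>2) \<le> 3/2 * (real n)\<^sup>2"
proof
  define Q where "Q N = (\<Sum>j\<in>J. q j (N j))" for N
  define \<mu> where "\<mu> = E n Q (\<lambda>_. 0)"
  have inner: "(\<Sum>j\<in>unseen N. correct (J - {j}) N (\<lambda>k. (real k - (\<mu> - 1/2))\<^sup>2))
      \<le> 2 * real n * (Q N - \<mu>)\<^sup>2 + (real n)\<^sup>2" for N
  proof -
    have "correct (J - {j}) N (\<lambda>k. (real k - (\<mu> - 1/2))\<^sup>2) \<le> (Q N - \<mu>)\<^sup>2 + real n / 2"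
      if j: "j \<in> unseen N" for j
    proof -
      have quarter: "x * (1 - x) \<le> 1/4" for x :: real
        using zero_le_power2[of "x - 1/2"] by (simp add: power2_eq_square algebra_simps)
      \<comment> \<open>The removed cell is unseen and accounts for exactly 1/2 of the mean, hence
        the centre \<open>\<mu> - 1/2\<close>.\<close>
      have "(\<Sum>j\<in>J - {j}. q j (N j)) = Q N - 1/2"
        using j fin q_0[of j] by (simp add: Q_def sum.remove[of J j])
      moreover have "(\<Sum>j\<in>J - {j}. q j (N j) * (1 - q j (N j))) \<le> (\<Sum>j\<in>J - {j}. 1/4)"
        by (intro sum_mono quarter)
      moreover have "card (J - {j}) \<le> 2 * n" using card card_mono[OF fin, of "J - {j}"] by auto
      ultimately show ?thesis
        using fin by (simp add: correct_def pbsum_second_moment)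
    qed
    then have "(\<Sum>j\<in>unseen N. correct (J - {j}) N (\<lambda>k. (real k - (\<mu> - 1/2))\<^sup>2))
        \<le> (\<Sum>j\<in>unseen N. (Q N - \<mu>)\<^sup>2 + real n / 2)"
      by (rule sum_mono)
    also have "\<dots> \<le> (\<Sum>j\<in>J. (Q N - \<mu>)\<^sup>2 + real n / 2)"
      by (rule sum_mono2) (use fin in auto)
    finally show ?thesis
      by (simp add: card power2_eq_square algebra_simps)
  qed
  \<comment> \<open>One visit raises \<open>Q\<close> by an amount between 0 and 1/2, so two
    different visits differ in effect by at most 1/2.\<close>
  have "Q (M(j := Suc (M j))) \<le> Q (M(k := Suc (M k))) + 1/2" if "j \<in> J" "k \<in> J" for M j k
  proof -
    have inc: "Q (M(i := Suc (M i))) = Q M + (q i (Suc (M i)) - q i (M i))" if "i \<in> J" for i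
      using that fin by (simp add: Q_def sum.remove[of J i])
    show ?thesis
      using inc[OF that(1)] inc[OF that(2)] q_bounds[OF that(1), of "Suc (M j)"] q_bounds[OF that(1), of "M j"]
        q_mono[OF that(2), of "M k"] by linarith
  qed
  then have var: "E n (\<lambda>M. (Q M - \<mu>)\<^sup>2) (\<lambda>_. 0) \<le> real n * (1/2)\<^sup>2"
    unfolding \<mu>_def by (rule E_variance)
  have "(\<Sum>s<card J. pivot n s * (real s - (\<mu> - 1/2))\<^sup>2)
      \<le> E n (\<lambda>N. 2 * real n * (Q N - \<mu>)\<^sup>2 + (real n)\<^sup>2) (\<lambda>_. 0)"
    unfolding pivot_moment by (rule E_mono) (rule inner)
  also have "\<dots> = 2 * real n * E n (\<lambda>M. (Q M - \<mu>)\<^sup>2) (\<lambda>_. 0) + (real n)\<^sup>2"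
    by (simp only: E_add E_cmult E_const)
  also have "\<dots> \<le> 2 * real n * (real n * (1/2)\<^sup>2) + (real n)\<^sup>2"
    by (intro add_mono mult_left_mono var) auto
  also have "\<dots> = 3/2 * (real n)\<^sup>2"
    by (simp add: power2_eq_square)
  finally show "(\<Sum>s<card J. pivot n s * (real s - (\<mu> - 1/2))\<^sup>2) \<le> 3/2 * (real n)\<^sup>2" .
qed

lemma pivot_nonneg: "0 \<le> pivot n s"
proof -
  have "0 \<le> (\<Sum>j\<in>unseen N. correct (J - {j}) N (\<lambda>k. of_bool (k = s)))" for N
    by (intro sum_nonneg correct_nonneg) auto
  then have "E n (\<lambda>_. 0) (\<lambda>_. 0) \<le> pivot n s"
    unfolding pivot_def by (rule E_mono)
  then show ?thesis by (simp only: E_const)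
qed

lemma pivot_sup_ge:
  assumes card: "card J = 2 * n" and n: "n \<ge> 1" and \<tau>: "\<And>s. pivot n s \<le> \<tau>"
  shows "real n / sqrt (18 * (real n + 1)) \<le> \<tau>"
proof -
  obtain c where c: "(\<Sum>s<card J. pivot n s * (real s - c)\<^sup>2) \<le> 3/2 * (real n)\<^sup>2"
    using pivot_second_moment[OF card] by blast
  \<comment> \<open>With mass at least \<open>n\<close> and second moment at most
    \<open>3/2 * n\<^sup>2\<close>, the dual bound reads
    \<open>3 * n * (R\<^sup>2 - K) / (4 * R ^ 3) \<le> \<tau>\<close>, whose left side is largest at
    \<open>R\<^sup>2 = 3 * K\<close>.\<close>
  define K where "K = 3/2 * real n + 1/12"
  define R where "R = sqrt (3 * K)"
  have K: "0 < K" and R: "0 < R" "R\<^sup>2 = 3 * K"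
    by (auto simp: K_def R_def add_nonneg_pos)
  have \<tau>0: "0 \<le> \<tau>" using pivot_nonneg[of n 0] \<tau>[of 0] by linarith
  have "(3 * K - 1/12) * real n - 4/3 * R ^ 3 * \<tau>
      \<le> (R\<^sup>2 - 1/12) * (\<Sum>s<card J. pivot n s) - 4/3 * R ^ 3 * \<tau>"
    unfolding R by (intro diff_right_mono mult_left_mono pivot_mass card) (auto simp: K_def)
  also have "\<dots> \<le> (\<Sum>s<card J. pivot n s * (real s - c)\<^sup>2)"
    by (rule bounded_weights_second_moment) (use pivot_nonneg \<tau> R \<tau>0 in auto)
  also note c
  finally have "2 * K * real n \<le> 4/3 * R ^ 3 * \<tau>"
    by (simp add: K_def power2_eq_square algebra_simps)
  also have "\<dots> = 2 * K * (2 * R * \<tau>)"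
    using R(2) by (simp add: power3_eq_cube power2_eq_square)
  finally have "real n \<le> 2 * R * \<tau>" using K by simp
  also have "2 * R = sqrt (4 * (3 * K))"
    by (simp only: R_def real_sqrt_mult[of 4] real_sqrt_four)
  \<comment> \<open>Here \<open>12 * K = 18 * n + 1\<close>.\<close>
  also have "sqrt (4 * (3 * K)) * \<tau> \<le> sqrt (18 * (real n + 1)) * \<tau>"
    by (intro mult_right_mono \<tau>0) (simp add: K_def)
  finally show ?thesis
    by (simp add: divide_le_eq mult.commute)
qed

text \<open>By \<open>draw_gain\<close> the gain at threshold \<open>Suc s\<close> is at least a
  multiple of \<open>pivot n s\<close>; a bound on the gains at all thresholds therefore bounds
  every pivotal mass, and \<open>pivot_sup_ge\<close> applies.\<close>

lemma success_gain_ge: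
  assumes card: "card J = 2 * n" and n: "n \<ge> 1"
    and \<epsilon>: "\<And>t. E (Suc n) (\<lambda>N. correct J N (\<lambda>k. of_bool (t \<le> k))) (\<lambda>_. 0)
      \<le> E n (\<lambda>N. correct J N (\<lambda>k. of_bool (t \<le> k))) (\<lambda>_. 0) + \<epsilon>"
  shows "b * (\<alpha>/2) * (real n / sqrt (18 * (real n + 1))) \<le> \<epsilon>"
proof -
  have "pivot n s \<le> \<epsilon> / (b * (\<alpha>/2))" for s
  proof -
    let ?f = "\<lambda>N. correct J N (\<lambda>k. of_bool (Suc s \<le> k))"
    have "E n (\<lambda>N. ?f N + b * (\<alpha>/2) * (\<Sum>j\<in>unseen N. correct (J - {j}) N (\<lambda>k. of_bool (k = s)))) (\<lambda>_. 0)
        \<le> E (Suc n) ?f (\<lambda>_. 0)"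
      unfolding E_Suc' using draw_gain[of _ s] by (intro E_mono) (simp add: algebra_simps)
    then have "E n ?f (\<lambda>_. 0) + b * (\<alpha>/2) * pivot n s \<le> E (Suc n) ?f (\<lambda>_. 0)"
      by (simp only: E_add E_cmult pivot_def)
    then have "b * (\<alpha>/2) * pivot n s \<le> \<epsilon>" using \<epsilon>[of "Suc s"] by linarith
    then show ?thesis
      using b_pos \<alpha>_pos by (simp add: field_simps)
  qed
  from pivot_sup_ge[OF card n this] show ?thesis
    using b_pos \<alpha>_pos by (simp add: field_simps)
qed

end

section \<open>Likelihoods on repeated experiments\<close>

text \<open>Both measures agree on measurable rectangles, where the integral of the product density
  factorises.\<close>

lemma PiM_density:
  assumes fin: "finite I" and M: "prob_space M" and M': "prob_space (density M g)"
    and [measurable]: "g \<in> borel_measurable M"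
  shows "Pi\<^sub>M I (\<lambda>_. density M g) = density (Pi\<^sub>M I (\<lambda>_. M)) (\<lambda>x. \<Prod>i\<in>I. g (x i))"
proof (rule sym, rule product_sigma_finite.PiM_eqI)
  interpret M: prob_space M by fact
  interpret M': prob_space "density M g" by fact
  interpret MI: product_sigma_finite "\<lambda>_. M" by standard
  show "product_sigma_finite (\<lambda>_. density M g)" by standard
  show "sets (density (Pi\<^sub>M I (\<lambda>_. M)) (\<lambda>x. \<Prod>i\<in>I. g (x i))) = sets (Pi\<^sub>M I (\<lambda>_. density M g))"
    by (simp cong: sets_PiM_cong)
  fix A assume "\<And>i. i \<in> I \<Longrightarrow> A i \<in> sets (density M g)"
  then have [measurable]: "A i \<in> sets M" if "i \<in> I" for i using that by simp
  have "emeasure (density (Pi\<^sub>M I (\<lambda>_. M)) (\<lambda>x. \<Prod>i\<in>I. g (x i))) (Pi\<^sub>E I A)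
      = (\<integral>\<^sup>+x. (\<Prod>i\<in>I. g (x i)) * indicator (Pi\<^sub>E I A) x \<partial>Pi\<^sub>M I (\<lambda>_. M))"
    using fin by (subst emeasure_density) (auto intro!: sets_PiM_I_finite)
  also have "\<dots> = (\<integral>\<^sup>+x. (\<Prod>i\<in>I. g (x i) * indicator (A i) (x i)) \<partial>Pi\<^sub>M I (\<lambda>_. M))"
  proof (rule nn_integral_cong)
    fix x assume "x \<in> space (Pi\<^sub>M I (\<lambda>_. M))"
    then have "x \<in> Pi\<^sub>E I A \<longleftrightarrow> (\<forall>i\<in>I. x i \<in> A i)"
      by (auto simp: space_PiM PiE_iff)
    moreover have "(\<Prod>i\<in>I. indicator (A i) (x i) :: ennreal) = (if \<forall>i\<in>I. x i \<in> A i then 1 else 0)"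
      using fin by (auto intro!: prod.neutral prod_zero simp: indicator_def)
    ultimately show "(\<Prod>i\<in>I. g (x i)) * indicator (Pi\<^sub>E I A) x
        = (\<Prod>i\<in>I. g (x i) * indicator (A i) (x i))"
      by (simp add: prod.distrib indicator_def)
  qed
  also have "\<dots> = (\<Prod>i\<in>I. emeasure (density M g) (A i))"
    using fin by (subst MI.product_nn_integral_prod) (auto simp: emeasure_density intro!: prod.cong)
  finally show "emeasure (density (Pi\<^sub>M I (\<lambda>_. M)) (\<lambda>x. \<Prod>i\<in>I. g (x i))) (Pi\<^sub>E I A)
      = (\<Prod>i\<in>I. emeasure (density M g) (A i))" .
qed (use fin in simp)

lemma integral_finite_discrete:
  fixes f :: "'b \<Rightarrow> real"
  assumes M: "finite_measure M" and sets: "sets M = Pow A" and A: "finite A"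
  shows "(\<integral>a. f a \<partial>M) = (\<Sum>a\<in>A. f a * measure M {a})"
proof -
  interpret finite_measure M by fact
  have sp: "space M = A" using sets by (metis sets.sets_into_space sets.top Pow_iff Pow_top subset_antisym)
  have "(\<integral>a. f a \<partial>M) = (\<integral>b. (\<Sum>a\<in>A. f a * indicator {a} b) \<partial>M)"
    using A by (intro Bochner_Integration.integral_cong) (auto simp: sp indicator_def)
  also have "\<dots> = (\<Sum>a\<in>A. f a * measure M {a})"
    using sets by (subst Bochner_Integration.integral_sum)
      (auto intro!: integrable_mult_right integrable_real_indicator simp: less_top[symmetric])
  finally show ?thesis .
qed

text \<open>Up to normalisation by the cell mass, the two candidate laws in each cell have densities
  \<open>1 + h\<close> and \<open>1 - h\<close> with respect to \<nu>. By \<open>h_mean\<close> the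
  choice between them leaves the cell mass unchanged, and \<open>h_abs\<close> expresses total
  variation distance at least \<alpha>.\<close>

locale signed_cells = prob_space \<nu> for \<nu> :: "'a measure" +
  fixes J :: "nat set" and S :: "nat \<Rightarrow> 'a set" and h :: "'a \<Rightarrow> real" and b \<alpha> :: real
  assumes finJ: "finite J" and S_sets [measurable]: "\<And>j. j \<in> J \<Longrightarrow> S j \<in> sets \<nu>"
    and disj: "disjoint_family_on S J" and cover: "(\<Union>j\<in>J. S j) = space \<nu>"
    and h_meas [measurable]: "h \<in> borel_measurable \<nu>" and h_bound: "\<And>x. \<bar>h x\<bar> \<le> 1"
    and cell_ge: "\<And>j. j \<in> J \<Longrightarrow> b \<le> measure \<nu> (S j)" and b_pos: "0 < b" and \<alpha>_pos: "0 < \<alpha>"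
    and h_mean: "\<And>j. j \<in> J \<Longrightarrow> (\<integral>x. indicator (S j) x * h x \<partial>\<nu>) = 0"
    and h_abs: "\<And>j. j \<in> J \<Longrightarrow> \<alpha> * measure \<nu> (S j) \<le> (\<integral>x. indicator (S j) x * \<bar>h x\<bar> \<partial>\<nu>)"
begin

abbreviation p where "p j \<equiv> measure \<nu> (S j)"

lemma p_pos: "j \<in> J \<Longrightarrow> 0 < p j"
  using cell_ge b_pos by force

lemma h_pm: "0 \<le> 1 + h y" "0 \<le> 1 - h y" "1 + h y \<le> 2" "1 - h y \<le> 2"
  using h_bound[of y] by (auto simp: abs_le_iff)

lemma cell_unique: "j \<in> J \<Longrightarrow> k \<in> J \<Longrightarrow> y \<in> S j \<Longrightarrow> y \<in> S k \<Longrightarrow> j = k"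
  using disj unfolding disjoint_family_on_def by blast

lemma p_sum: "sum p J = 1"
proof -
  have "sum p J = measure \<nu> (\<Union>j\<in>J. S j)"
    using finJ disj by (intro finite_measure_finite_Union[symmetric]) auto
  then show ?thesis by (simp add: cover prob_space)
qed

sublocale cell_weights J p
  by standard (use finJ p_sum in auto)

text \<open>A class of functions with finite integrals that is closed under \<open>observe\<close>:
  the bound \<open>u + v\<close> is preserved because \<open>observe\<close> fixes it.\<close>

definition good :: "(real \<Rightarrow> real \<Rightarrow> real) \<Rightarrow> bool" where
  "good H \<longleftrightarrow> (\<lambda>z. H (fst z) (snd z)) \<in> borel_measurable (borel \<Otimes>\<^sub>M borel) \<and>
     (\<forall>u v. 0 \<le> u \<longrightarrow> 0 \<le> v \<longrightarrow> 0 \<le> H u v \<and> H u v \<le> u + v)"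

text \<open>
  The expectation of \<open>H\<close> at the two likelihoods \<open>u\<close>, \<open>v\<close> of a cell after one more observation in it.
\<close>

definition observe :: "nat \<Rightarrow> (real \<Rightarrow> real \<Rightarrow> real) \<Rightarrow> real \<Rightarrow> real \<Rightarrow> real" where
  "observe j H u v = (\<integral>y. indicator (S j) y * H (u * (1 + h y)) (v * (1 - h y)) \<partial>\<nu>) / p j"

lemma good_measurable:
  assumes "good H" "f \<in> borel_measurable M" "g \<in> borel_measurable M"
  shows "(\<lambda>x. H (f x) (g x)) \<in> borel_measurable M"
  using measurable_compose[of "\<lambda>x. (f x, g x)" M "borel \<Otimes>\<^sub>M borel" "\<lambda>z. H (fst z) (snd z)"] assms
  by (simp add: good_def)

lemma observe_integrable:
  assumes H: "good H" and "0 \<le> u" "0 \<le> v" "j \<in> J"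
  shows "integrable \<nu> (\<lambda>y. indicator (S j) y * H (u * (1 + h y)) (v * (1 - h y)))"
proof (rule integrable_const_bound[where B = "2 * u + 2 * v"])
  show "AE y in \<nu>. norm (indicator (S j) y * H (u * (1 + h y)) (v * (1 - h y))) \<le> 2 * u + 2 * v"
  proof (rule AE_I2)
    fix y
    have "0 \<le> H (u * (1 + h y)) (v * (1 - h y))"
      "H (u * (1 + h y)) (v * (1 - h y)) \<le> u * (1 + h y) + v * (1 - h y)"
      using H assms h_pm by (auto simp: good_def)
    moreover have "u * (1 + h y) \<le> u * 2" "v * (1 - h y) \<le> v * 2"
      by (intro mult_left_mono h_pm assms)+
    ultimately show "norm (indicator (S j) y * H (u * (1 + h y)) (v * (1 - h y))) \<le> 2 * u + 2 * v"
      by (simp add: indicator_def)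
  qed
  have [measurable]: "(\<lambda>y. H (u * (1 + h y)) (v * (1 - h y))) \<in> borel_measurable \<nu>"
    by (rule good_measurable[OF H]) auto
  show "(\<lambda>y. indicator (S j) y * H (u * (1 + h y)) (v * (1 - h y))) \<in> borel_measurable \<nu>"
    using assms(4) by measurable
qed

lemma cell_integrable [simp]:
  assumes "j \<in> J"
  shows "integrable \<nu> (\<lambda>y. indicator (S j) y * h y)" "integrable \<nu> (\<lambda>y. indicator (S j) y * \<bar>h y\<bar>)"
    "integrable \<nu> (indicator (S j) :: 'a \<Rightarrow> real)"
proof -
  show "integrable \<nu> (\<lambda>y. indicator (S j) y * h y)" "integrable \<nu> (\<lambda>y. indicator (S j) y * \<bar>h y\<bar>)"
    by (rule integrable_const_bound[where B = 1]; use assms h_bound in \<open>auto simp: indicator_def\<close>)+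
  show "integrable \<nu> (indicator (S j) :: 'a \<Rightarrow> real)"
    using assms by (intro integrable_real_indicator) (auto simp: less_top[symmetric])
qed

text \<open>Both likelihoods are martingales, since \<open>h\<close> has mean zero on the
  cell.\<close>

lemma observe_affine:
  assumes j: "j \<in> J"
  shows "observe j (\<lambda>u v. c * u + d * v) u v = c * u + d * v"
proof -
  have "(\<integral>y. indicator (S j) y * (c * (u * (1 + h y)) + d * (v * (1 - h y))) \<partial>\<nu>)
      = (\<integral>y. (c * u + d * v) * indicator (S j) y + (c * u - d * v) * (indicator (S j) y * h y) \<partial>\<nu>)"
    by (simp add: algebra_simps)
  also have "\<dots> = (c * u + d * v) * p j"
    using j by (subst Bochner_Integration.integral_add) (auto simp: h_mean)
  finally show ?thesis
    using p_pos[OF j] by (simp add: observe_def)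
qed

lemma observe_mono:
  assumes j: "j \<in> J" and "good H" "good K" and le: "\<And>u v. 0 \<le> u \<Longrightarrow> 0 \<le> v \<Longrightarrow> H u v \<le> K u v"
    and uv: "0 \<le> u" "0 \<le> v"
  shows "observe j H u v \<le> observe j K u v"
  unfolding observe_def
  using p_pos[OF j] assms h_pm
  by (intro divide_right_mono integral_mono observe_integrable mult_left_mono) auto

lemma good_sum: "good (\<lambda>u v. 1 * u + 1 * v)"
  by (auto simp: good_def)

lemma observe_good:
  assumes j: "j \<in> J" and H: "good H"
  shows "good (observe j H)"
  unfolding good_def
proof (intro conjI allI impI)
  let ?B = "borel \<Otimes>\<^sub>M borel :: (real \<times> real) measure"
  show "(\<lambda>z. observe j H (fst z) (snd z)) \<in> borel_measurable ?B"
  proof -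
    have [measurable]: "(\<lambda>(z, y). H (fst z * (1 + h y)) (snd z * (1 - h y))) \<in> borel_measurable (?B \<Otimes>\<^sub>M \<nu>)"
      unfolding split_beta' by (rule good_measurable[OF H]; measurable)
    have "(\<lambda>(z, y). indicator (S j) y * H (fst z * (1 + h y)) (snd z * (1 - h y))) \<in> borel_measurable (?B \<Otimes>\<^sub>M \<nu>)"
      using j by measurable
    then have "(\<lambda>z. \<integral>y. indicator (S j) y * H (fst z * (1 + h y)) (snd z * (1 - h y)) \<partial>\<nu>) \<in> borel_measurable ?B"
      by (rule borel_measurable_lebesgue_integral)
    then show ?thesis unfolding observe_def by measurable
  qed
next
  fix u v :: real assume uv: "0 \<le> u" "0 \<le> v"
  show "0 \<le> observe j H u v"
    unfolding observe_def using H uv h_pm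
    by (intro divide_nonneg_nonneg Bochner_Integration.integral_nonneg mult_nonneg_nonneg) (auto simp: good_def)
  have "observe j H u v \<le> observe j (\<lambda>u v. 1 * u + 1 * v) u v"
    using uv H by (intro observe_mono j H good_sum) (auto simp: good_def)
  then show "observe j H u v \<le> u + v"
    by (subst (asm) observe_affine[OF j]) simp
qed

lemma observe_pow_good: "j \<in> J \<Longrightarrow> good H \<Longrightarrow> good ((observe j ^^ k) H)"
  by (induction k) (auto intro: observe_good)

text \<open>Observations outside \<open>S j\<close> say nothing about coordinate \<open>j\<close>
  and count as 1, so that the density of a whole index is a product over all of
  \<open>J\<close>.\<close>

definition factor :: "nat \<Rightarrow> bool \<Rightarrow> 'a \<Rightarrow> real" where
  "factor j c y = (if y \<in> S j then (if c then 1 + h y else 1 - h y) else 1)"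

definition lik :: "nat \<Rightarrow> bool \<Rightarrow> nat \<Rightarrow> (nat \<Rightarrow> 'a) \<Rightarrow> real" where
  "lik j c n x = (\<Prod>l<n. factor j c (x l))"

abbreviation \<nu>n where "\<nu>n n \<equiv> Pi\<^sub>M {..<n} (\<lambda>_. \<nu>)"

lemma factor_bounds: "0 \<le> factor j c y" "factor j c y \<le> 2"
  using h_pm by (auto simp: factor_def)

lemma lik_bounds: "0 \<le> lik j c n x" "lik j c n x \<le> 2 ^ n"
proof -
  show "0 \<le> lik j c n x" unfolding lik_def by (intro prod_nonneg) (auto simp: factor_bounds)
  have "lik j c n x \<le> (\<Prod>l<n. 2)"
    unfolding lik_def by (intro prod_mono) (auto simp: factor_bounds)
  then show "lik j c n x \<le> 2 ^ n" by simp
qed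

lemma factor_measurable [measurable]: "j \<in> J \<Longrightarrow> factor j c \<in> borel_measurable \<nu>"
  unfolding factor_def by (cases c) simp_all

lemma lik_measurable [measurable]:
  assumes "j \<in> J"
  shows "lik j c n \<in> borel_measurable (\<nu>n n)"
  unfolding lik_def
proof (rule borel_measurable_prod)
  fix l assume "l \<in> {..<n}"
  then have "(\<lambda>x. x l) \<in> \<nu>n n \<rightarrow>\<^sub>M \<nu>" by (rule measurable_component_singleton)
  then show "(\<lambda>x. factor j c (x l)) \<in> borel_measurable (\<nu>n n)"
    using factor_measurable[OF assms] by (rule measurable_compose)
qed

lemma \<nu>n_prob: "prob_space (\<nu>n n)"
  by (intro prob_space_PiM prob_space_axioms)

lemma state_prod_integrable:
  assumes H: "\<And>j. j \<in> J \<Longrightarrow> good (H j)"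
  shows "integrable (\<nu>n n) (\<lambda>x. \<Prod>j\<in>J. H j (lik j True n x) (lik j False n x))"
proof -
  interpret N: prob_space "\<nu>n n" by (rule \<nu>n_prob)
  show ?thesis
  proof (rule N.integrable_const_bound[where B = "\<Prod>j\<in>J. 2 ^ n + 2 ^ n"])
    show "AE x in \<nu>n n. norm (\<Prod>j\<in>J. H j (lik j True n x) (lik j False n x)) \<le> (\<Prod>j\<in>J. 2 ^ n + 2 ^ n)"
    proof (rule AE_I2)
      fix x
      have "0 \<le> H j (lik j True n x) (lik j False n x)"
        "H j (lik j True n x) (lik j False n x) \<le> 2 ^ n + 2 ^ n" if "j \<in> J" for j
        using H[OF that] lik_bounds[of j True n x] lik_bounds[of j False n x]
        unfolding good_def by (meson add_mono order_trans)+
      then show "norm (\<Prod>j\<in>J. H j (lik j True n x) (lik j False n x)) \<le> (\<Prod>j\<in>J. 2 ^ n + 2 ^ n)"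
        unfolding prod_norm[symmetric] by (intro prod_mono) auto
    qed
    show "(\<lambda>x. \<Prod>j\<in>J. H j (lik j True n x) (lik j False n x)) \<in> borel_measurable (\<nu>n n)"
      by (rule borel_measurable_prod) (rule good_measurable[OF H lik_measurable lik_measurable])
  qed
qed

text \<open>The observation falls into exactly one cell \<open>i\<close>, with probability
  \<open>p i\<close>, and updates the likelihoods of coordinate \<open>i\<close> alone; the other
  factors are constants under the integral.\<close>

lemma one_observation:
  assumes H: "\<And>j. j \<in> J \<Longrightarrow> good (H j)" and uv: "\<And>j. 0 \<le> u j" "\<And>j. 0 \<le> v j"
  shows "(\<integral>y. (\<Prod>j\<in>J. H j (u j * factor j True y) (v j * factor j False y)) \<partial>\<nu>)
    = (\<Sum>i\<in>J. p i * (\<Prod>j\<in>J. (H(i := observe i (H i))) j (u j) (v j)))"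
proof -
  let ?R = "\<lambda>i. \<Prod>j\<in>J - {i}. H j (u j) (v j)"
  let ?f = "\<lambda>i y. indicator (S i) y * H i (u i * (1 + h y)) (v i * (1 - h y))"
  have "(\<integral>y. (\<Prod>j\<in>J. H j (u j * factor j True y) (v j * factor j False y)) \<partial>\<nu>)
      = (\<integral>y. (\<Sum>i\<in>J. ?f i y * ?R i) \<partial>\<nu>)"
  proof (rule Bochner_Integration.integral_cong[OF refl])
    fix y assume "y \<in> space \<nu>"
    then obtain i where i: "i \<in> J" "y \<in> S i" using cover by blast
    have other: "y \<notin> S j" if "j \<in> J" "j \<noteq> i" for j
      using cell_unique i that by blast
    have "(\<Prod>j\<in>J. H j (u j * factor j True y) (v j * factor j False y))
        = H i (u i * (1 + h y)) (v i * (1 - h y)) * ?R i"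
      using i finJ other by (subst prod.remove[of J i]) (auto simp: factor_def intro!: prod.cong)
    also have "\<dots> = (\<Sum>j\<in>J. if j = i then H j (u j * (1 + h y)) (v j * (1 - h y)) * ?R j else 0)"
      using i finJ by simp
    also have "\<dots> = (\<Sum>j\<in>J. ?f j y * ?R j)"
      using i other by (intro sum.cong) (auto simp: indicator_def)
    finally show "(\<Prod>j\<in>J. H j (u j * factor j True y) (v j * factor j False y)) = (\<Sum>j\<in>J. ?f j y * ?R j)" .
  qed
  also have "\<dots> = (\<Sum>i\<in>J. (\<integral>y. ?f i y \<partial>\<nu>) * ?R i)"
    using H uv by (subst Bochner_Integration.integral_sum) (auto intro!: integrable_mult_left observe_integrable)
  also have "\<dots> = (\<Sum>i\<in>J. p i * (\<Prod>j\<in>J. (H(i := observe i (H i))) j (u j) (v j)))"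
  proof (rule sum.cong[OF refl])
    fix i assume i: "i \<in> J"
    have "(\<Prod>j\<in>J. (H(i := observe i (H i))) j (u j) (v j)) = observe i (H i) (u i) (v i) * ?R i"
      using i finJ by (subst prod.remove[of J i]) (auto intro!: prod.cong)
    then show "(\<integral>y. ?f i y \<partial>\<nu>) * ?R i = p i * (\<Prod>j\<in>J. (H(i := observe i (H i))) j (u j) (v j))"
      using p_pos[OF i] by (simp add: observe_def)
  qed
  finally show ?thesis .
qed

text \<open>Given the counts, the likelihood pairs of different coordinates evolve independently,
  each by its own \<open>observe\<close>. The induction integrates out the last observation, which
  replaces one \<open>H i\<close> by \<open>observe i (H i)\<close>; hence the family
  \<open>H\<close> must be arbitrary.\<close>

lemma state_integral:
  assumes H: "\<And>j. j \<in> J \<Longrightarrow> good (H j)"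
  shows "(\<integral>x. (\<Prod>j\<in>J. H j (lik j True n x) (lik j False n x)) \<partial>\<nu>n n)
    = E n (\<lambda>N. \<Prod>j\<in>J. (observe j ^^ N j) (H j) 1 1) (\<lambda>_. 0)"
  using H
proof (induction n arbitrary: H)
  case 0
  interpret N: prob_space "\<nu>n 0" by (rule \<nu>n_prob)
  have "lik j c 0 x = 1" for j c x by (simp add: lik_def)
  then show ?case
    by (simp only: lebesgue_integral_const N.prob_space scaleR_one funpow_0)
next
  case (Suc n)
  interpret product_sigma_finite "\<lambda>_ :: nat. \<nu>"
    by standard
  let ?H = "\<lambda>i. H(i := observe i (H i))"
  have good: "good (?H i j)" if "i \<in> J" "j \<in> J" for i j
    using that Suc.prems by (auto intro: observe_good)
  have upd: "lik j c (Suc n) (x(n := y)) = lik j c n x * factor j c y" for j c x y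
    by (simp add: lik_def)
  have "(\<integral>x. (\<Prod>j\<in>J. H j (lik j True (Suc n) x) (lik j False (Suc n) x)) \<partial>\<nu>n (Suc n))
      = (\<integral>x. (\<integral>y. (\<Prod>j\<in>J. H j (lik j True n x * factor j True y) (lik j False n x * factor j False y)) \<partial>\<nu>) \<partial>\<nu>n n)"
    using state_prod_integrable[where H = H and n = "Suc n", OF Suc.prems] unfolding lessThan_Suc
    by (subst product_integral_insert) (auto simp: upd)
  also have "\<dots> = (\<integral>x. (\<Sum>i\<in>J. p i * (\<Prod>j\<in>J. ?H i j (lik j True n x) (lik j False n x))) \<partial>\<nu>n n)"
    by (intro Bochner_Integration.integral_cong refl one_observation Suc.prems lik_bounds)
  also have "\<dots> = (\<Sum>i\<in>J. p i * (\<integral>x. (\<Prod>j\<in>J. ?H i j (lik j True n x) (lik j False n x)) \<partial>\<nu>n n))"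
    using good by (subst Bochner_Integration.integral_sum) (auto intro!: integrable_mult_right state_prod_integrable)
  also have "\<dots> = (\<Sum>i\<in>J. p i * E n (\<lambda>N. \<Prod>j\<in>J. (observe j ^^ N j) (?H i j) 1 1) (\<lambda>_. 0))"
    using good by (intro sum.cong refl arg_cong2[where f = "(*)"] Suc.IH)
  also have "\<dots> = E n (\<lambda>N. \<Sum>i\<in>J. p i * (\<Prod>j\<in>J. (observe j ^^ N j) (?H i j) 1 1)) (\<lambda>_. 0)"
    by (simp add: E_sum E_cmult)
  \<comment> \<open>An \<open>observe i\<close> applied innermost amounts to one more count in cell
    \<open>i\<close>.\<close>
  also have "(\<lambda>N. \<Sum>i\<in>J. p i * (\<Prod>j\<in>J. (observe j ^^ N j) (?H i j) 1 1))
      = draw J p (\<lambda>N. \<Prod>j\<in>J. (observe j ^^ N j) (H j) 1 1)"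
    unfolding draw_def
    by (intro ext sum.cong refl arg_cong2[where f = "(*)"] prod.cong) (auto simp: funpow_swap1)
  finally show ?case by (simp only: E_Suc')
qed

section \<open>Guessing a single coordinate under a fair prior\<close>

abbreviation "half_max \<equiv> \<lambda>u v :: real. max u v / 2"
abbreviation "half_min \<equiv> \<lambda>u v :: real. min u v / 2"

lemma good_half: "good half_max" "good half_min"
  by (auto simp: good_def)

text \<open>Under a fair prior half the larger likelihood is the weight of a correct guess, so this
  is the Bayes probability of guessing coordinate \<open>j\<close> after \<open>k\<close> visits to
  its cell.\<close>

definition q :: "nat \<Rightarrow> nat \<Rightarrow> real" where
  "q j k = (observe j ^^ k) half_max 1 1"

text \<open>Maximum and minimum add up to \<open>u + v\<close>, which \<open>observe\<close>
  fixes.\<close>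

lemma observe_half_min:
  assumes j: "j \<in> J" and uv: "0 \<le> u" "0 \<le> v"
  shows "(observe j ^^ k) half_min u v = (u + v) / 2 - (observe j ^^ k) half_max u v"
  using uv
proof (induction k arbitrary: u v)
  case (Suc k)
  let ?M = "(observe j ^^ k) half_max"
  have "(\<integral>y. indicator (S j) y * (observe j ^^ k) half_min (u * (1 + h y)) (v * (1 - h y)) \<partial>\<nu>)
    = (\<integral>y. indicator (S j) y * (1/2 * (u * (1 + h y)) + 1/2 * (v * (1 - h y)))
        - indicator (S j) y * ?M (u * (1 + h y)) (v * (1 - h y)) \<partial>\<nu>)"
  proof (rule Bochner_Integration.integral_cong[OF refl])
    fix y
    have "(observe j ^^ k) half_min (u * (1 + h y)) (v * (1 - h y))
        = 1/2 * (u * (1 + h y)) + 1/2 * (v * (1 - h y)) - ?M (u * (1 + h y)) (v * (1 - h y))"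
      using Suc.IH[of "u * (1 + h y)" "v * (1 - h y)"] Suc.prems h_pm by (simp add: add_divide_distrib)
    then show "indicator (S j) y * (observe j ^^ k) half_min (u * (1 + h y)) (v * (1 - h y))
        = indicator (S j) y * (1/2 * (u * (1 + h y)) + 1/2 * (v * (1 - h y)))
          - indicator (S j) y * ?M (u * (1 + h y)) (v * (1 - h y))"
      by (simp only: right_diff_distrib)
  qed
  also have "\<dots> = (\<integral>y. indicator (S j) y * (1/2 * (u * (1 + h y)) + 1/2 * (v * (1 - h y))) \<partial>\<nu>)
      - (\<integral>y. indicator (S j) y * ?M (u * (1 + h y)) (v * (1 - h y)) \<partial>\<nu>)"
  proof (rule Bochner_Integration.integral_diff)
    have "good (\<lambda>u v. 1/2 * u + 1/2 * v)" by (auto simp: good_def)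
    from observe_integrable[OF this Suc.prems j]
    show "integrable \<nu> (\<lambda>y. indicator (S j) y * (1/2 * (u * (1 + h y)) + 1/2 * (v * (1 - h y))))" .
    show "integrable \<nu> (\<lambda>y. indicator (S j) y * ?M (u * (1 + h y)) (v * (1 - h y)))"
      by (rule observe_integrable[OF observe_pow_good[OF j good_half(1)] Suc.prems j])
  qed
  finally have "observe j ((observe j ^^ k) half_min) u v
      = observe j (\<lambda>u v. 1/2 * u + 1/2 * v) u v - observe j ?M u v"
    by (simp add: observe_def diff_divide_distrib)
  then show ?case by (simp only: observe_affine[OF j]) (simp add: add_divide_distrib)
qed (auto simp: max_def min_def field_simps)

lemma q_min: "j \<in> J \<Longrightarrow> (observe j ^^ k) half_min 1 1 = 1 - q j k"
  by (simp add: observe_half_min q_def)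

text \<open>Jensen's inequality: the maximum is the upper envelope of two linear functions, and
  \<open>observe\<close> fixes both.\<close>

lemma half_max_le_observe:
  assumes j: "j \<in> J" and uv: "0 \<le> u" "0 \<le> v"
  shows "half_max u v \<le> observe j half_max u v"
proof -
  have "c * u + d * v \<le> observe j half_max u v"
    if "\<And>u v. 0 \<le> u \<Longrightarrow> 0 \<le> v \<Longrightarrow> c * u + d * v \<le> half_max u v" "0 \<le> c" "c \<le> 1" "0 \<le> d" "d \<le> 1" for c d
  proof -
    have "good (\<lambda>u v. c * u + d * v)"
      unfolding good_def using that by (auto intro!: add_mono mult_left_le_one_le)
    then have "observe j (\<lambda>u v. c * u + d * v) u v \<le> observe j half_max u v"
      by (rule observe_mono[OF j _ good_half(1) that(1) uv])
    then show ?thesis by (simp only: observe_affine[OF j])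
  qed
  from this[of "1/2" 0] this[of 0 "1/2"] show ?thesis by simp
qed

text \<open>More data cannot hurt: monotonicity of \<open>observe\<close> propagates
  \<open>half_max_le_observe\<close> to all iterates.\<close>

lemma q_mono_Suc:
  assumes j: "j \<in> J"
  shows "q j k \<le> q j (Suc k)"
proof -
  have "(observe j ^^ k) half_max u v \<le> (observe j ^^ Suc k) half_max u v" if "0 \<le> u" "0 \<le> v" for u v
    using that
  proof (induction k arbitrary: u v)
    case 0
    then show ?case using half_max_le_observe[OF j] by simp
  next
    case (Suc k)
    have "observe j ((observe j ^^ k) half_max) u v \<le> observe j ((observe j ^^ Suc k) half_max) u v"
      by (intro observe_mono j observe_pow_good good_half Suc)
    then show ?case by simp
  qed
  then show ?thesis by (simp only: q_def zero_le_one)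
qed

sublocale cell_posteriors J p q b \<alpha>
proof
  fix j k assume j: "j \<in> J"
  have q0: "q j 0 = 1/2" by (simp add: q_def)
  have "incseq (q j)" by (rule incseq_SucI) (rule q_mono_Suc[OF j])
  then have "q j 0 \<le> q j k" by (rule incseqD) simp
  moreover have "0 \<le> 1 - q j k"
    using observe_pow_good[OF j good_half(2), of k] by (simp add: good_def q_min[OF j, symmetric])
  ultimately show "1/2 \<le> q j k \<and> q j k \<le> 1" using q0 by simp
  show "q j k \<le> q j (Suc k)" by (rule q_mono_Suc[OF j])
  show "q j 0 = 1/2" by (rule q0)
  \<comment> \<open>The maximum of \<open>1 + h\<close> and \<open>1 - h\<close> is
    \<open>1 + \<bar>h\<bar>\<close>, so the first visit gains half the normalised integral of
    \<open>\<bar>h\<bar>\<close>.\<close>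
  have "(\<integral>y. indicator (S j) y * half_max (1 * (1 + h y)) (1 * (1 - h y)) \<partial>\<nu>)
      = (\<integral>y. indicator (S j) y / 2 + (indicator (S j) y * \<bar>h y\<bar>) / 2 \<partial>\<nu>)"
    by (intro Bochner_Integration.integral_cong) (auto simp: indicator_def max_def abs_if field_simps)
  also have "\<dots> = p j / 2 + (\<integral>y. indicator (S j) y * \<bar>h y\<bar> \<partial>\<nu>) / 2"
    using j by (subst Bochner_Integration.integral_add) auto
  finally have "q j 1 = 1/2 + (\<integral>y. indicator (S j) y * \<bar>h y\<bar> \<partial>\<nu>) / (2 * p j)"
    using p_pos[OF j] by (simp add: q_def observe_def field_simps)
  also have "\<dots> \<ge> 1/2 + \<alpha> / 2"
    using h_abs[OF j] p_pos[OF j] by (simp add: field_simps)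
  finally show "1/2 + \<alpha>/2 \<le> q j 1" .
  show "b \<le> p j" by (rule cell_ge[OF j])
qed (use b_pos \<alpha>_pos in auto)

text \<open>The weight, under the uniform prior, of the event that the maximum likelihood guess has
  at least \<open>t\<close> correct coordinates; its integral is the Bayes success
  probability.\<close>

definition best :: "nat \<Rightarrow> nat \<Rightarrow> (nat \<Rightarrow> 'a) \<Rightarrow> real" where
  "best t n x = pbsum J (\<lambda>j. half_max (lik j True n x) (lik j False n x))
     (\<lambda>j. half_min (lik j True n x) (lik j False n x)) (\<lambda>k. of_bool (t \<le> k))"

text \<open>Sorted by the set \<open>C\<close> of correct coordinates, the summands become products
  over \<open>J\<close> of the kind that \<open>state_integral\<close> evaluates.\<close>

lemma best_expand:
  "best t n x = (\<Sum>C\<in>Pow J. of_bool (t \<le> card C) *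
    (\<Prod>j\<in>J. (if j \<in> C then half_max else half_min) (lik j True n x) (lik j False n x)))"
  unfolding best_def pbsum_prod_if[OF finJ]
  by (intro sum.cong refl) (simp add: if_distribR cong: if_cong)

lemma best_integrable: "integrable (\<nu>n n) (best t n)"
  and best_integral: "(\<integral>x. best t n x \<partial>\<nu>n n) = E n (\<lambda>N. correct J N (\<lambda>k. of_bool (t \<le> k))) (\<lambda>_. 0)"
proof -
  let ?H = "\<lambda>C j. if j \<in> C then half_max else half_min"
  have good: "good (?H C j)" for C j using good_half by auto
  have int: "integrable (\<nu>n n) (\<lambda>x. of_bool (t \<le> card C) * (\<Prod>j\<in>J. ?H C j (lik j True n x) (lik j False n x)))" for C
    by (intro integrable_mult_right state_prod_integrable good)
  show "integrable (\<nu>n n) (best t n)"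
    unfolding best_expand[abs_def] by (intro Bochner_Integration.integrable_sum int)
  have "(\<integral>x. best t n x \<partial>\<nu>n n)
      = (\<Sum>C\<in>Pow J. of_bool (t \<le> card C) * E n (\<lambda>N. \<Prod>j\<in>J. (observe j ^^ N j) (?H C j) 1 1) (\<lambda>_. 0))"
    unfolding best_expand
    by (subst Bochner_Integration.integral_sum[OF int])
      (simp only: integral_mult_right_zero state_integral[OF good])
  also have "\<dots> = E n (\<lambda>N. \<Sum>C\<in>Pow J. of_bool (t \<le> card C) * (\<Prod>j\<in>J. (observe j ^^ N j) (?H C j) 1 1)) (\<lambda>_. 0)"
    by (simp add: E_sum E_cmult)
  also have "(\<lambda>N. \<Sum>C\<in>Pow J. of_bool (t \<le> card C) * (\<Prod>j\<in>J. (observe j ^^ N j) (?H C j) 1 1))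
      = (\<lambda>N. correct J N (\<lambda>k. of_bool (t \<le> k)))"
    unfolding correct_def pbsum_def
  proof (intro ext sum.cong refl)
    fix N C assume "C \<in> Pow J"
    then have C: "C \<subseteq> J" "finite C" using finJ finite_subset by auto
    have "(\<Prod>j\<in>J. (observe j ^^ N j) (?H C j) 1 1) = (\<Prod>j\<in>J. if j \<in> C then q j (N j) else 1 - q j (N j))"
      by (intro prod.cong refl) (auto simp: q_min, simp add: q_def)
    also have "\<dots> = (\<Prod>j\<in>C. q j (N j)) * (\<Prod>j\<in>J - C. 1 - q j (N j))"
      using C finJ by (simp add: prod.If_cases Int_absorb1 Diff_eq Collect_mem_eq)
    finally show "of_bool (t \<le> card C) * (\<Prod>j\<in>J. (observe j ^^ N j) (?H C j) 1 1)
        = (\<Prod>j\<in>C. q j (N j)) * (\<Prod>j\<in>J - C. 1 - q j (N j)) * of_bool (t \<le> card C)"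
      by simp
  qed
  finally show "(\<integral>x. best t n x \<partial>\<nu>n n) = E n (\<lambda>N. correct J N (\<lambda>k. of_bool (t \<le> k))) (\<lambda>_. 0)" .
qed

end

section \<open>The Bayes risk of the guessing problem\<close>

text \<open>Embeds the cube of indices into the parameter set; an index is encoded as the set
  \<open>I\<close> of those cells in which the density is \<open>1 + h\<close>.\<close>

locale signed_experiment = signed_cells \<nu> J S h b \<alpha>
  for \<nu> :: "'a measure" and J :: "nat set" and S h b \<alpha> +
  fixes \<Theta> :: "'t set" and X :: "'a measure" and P :: "'t \<Rightarrow> 'a measure" and \<theta> :: "nat set \<Rightarrow> 't"
  assumes sets_\<nu>: "sets \<nu> = sets X"
    and \<theta>_in: "\<And>I. I \<subseteq> J \<Longrightarrow> \<theta> I \<in> \<Theta>" and \<theta>_inj: "inj_on \<theta> (Pow J)"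
    and P_density: "\<And>I. I \<subseteq> J \<Longrightarrow> P (\<theta> I) = density \<nu> (\<lambda>y. ennreal (\<Prod>j\<in>J. factor j (j \<in> I) y))"
    and P_prob: "\<And>I. I \<subseteq> J \<Longrightarrow> prob_space (P (\<theta> I))"
begin

abbreviation weight :: "nat set \<Rightarrow> nat \<Rightarrow> (nat \<Rightarrow> 'a) \<Rightarrow> real" where
  "weight I n x \<equiv> \<Prod>j\<in>J. lik j (j \<in> I) n x"

lemma weight_nonneg: "0 \<le> weight I n x"
  by (intro prod_nonneg) (auto simp: lik_bounds)

lemma rep_density:
  assumes I: "I \<subseteq> J"
  shows "rep_family n P (\<theta> I) = density (\<nu>n n) (\<lambda>x. ennreal (weight I n x))"
proof -
  let ?g = "\<lambda>y. ennreal (\<Prod>j\<in>J. factor j (j \<in> I) y)"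
  have "rep_family n P (\<theta> I) = Pi\<^sub>M {..<n} (\<lambda>_. density \<nu> ?g)"
    by (simp add: rep_family_def P_density[OF I])
  also have "\<dots> = density (\<nu>n n) (\<lambda>x. \<Prod>l<n. ?g (x l))"
    using P_prob[OF I] by (intro PiM_density prob_space_axioms) (auto simp: P_density[OF I])
  also have "(\<lambda>x. \<Prod>l<n. ?g (x l)) = (\<lambda>x. ennreal (weight I n x))"
    unfolding lik_def
    by (subst prod.swap) (simp add: prod_ennreal prod_nonneg factor_bounds)
  finally show ?thesis .
qed

lemma weight_integrable: "integrable (\<nu>n n) (weight I n)"
proof -
  have "good (if j \<in> I then (\<lambda>u v. u) else (\<lambda>u v. v))" for j
    by (auto simp: good_def)
  from state_prod_integrable[of "\<lambda>j. if j \<in> I then (\<lambda>u v. u) else (\<lambda>u v. v)" n, OF this]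
  show ?thesis by (rule Bochner_Integration.integrable_cong[THEN iffD1, rotated -1]) (auto intro!: prod.cong)
qed

lemma weight_measurable [measurable]: "weight I n \<in> borel_measurable (\<nu>n n)"
  by (rule borel_measurable_integrable[OF weight_integrable])

lemma weight_integral:
  assumes I: "I \<subseteq> J"
  shows "(\<integral>x. weight I n x \<partial>\<nu>n n) = 1"
proof -
  have "prob_space (rep_family n P (\<theta> I))"
    unfolding rep_family_def by (intro prob_space_PiM P_prob I)
  then have "(\<integral>x. 1 \<partial>rep_family n P (\<theta> I)) = (1::real)"
    by (simp add: prob_space.prob_space)
  then show ?thesis
    unfolding rep_density[OF I] by (subst (asm) integral_density) (auto simp: weight_nonneg)
qed

lemma integrable_weight_mult:
  assumes f: "f \<in> borel_measurable (\<nu>n n)" and bound: "\<And>x. x \<in> space (\<nu>n n) \<Longrightarrow> \<bar>f x\<bar> \<le> 1"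
  shows "integrable (\<nu>n n) (\<lambda>x. f x * weight I n x)"
proof (rule Bochner_Integration.integrable_bound[OF weight_integrable])
  show "(\<lambda>x. f x * weight I n x) \<in> borel_measurable (\<nu>n n)" using f by measurable
  show "AE x in \<nu>n n. norm (f x * weight I n x) \<le> norm (weight I n x)"
    using bound by (intro AE_I2) (auto simp: abs_mult intro!: mult_left_le_one_le)
qed

section \<open>The guessing problem and its optimal guess\<close>

definition actions :: "nat set" where
  "actions = set_encode ` Pow J"

definition hits :: "nat set \<Rightarrow> nat \<Rightarrow> nat" where
  "hits I a = card {j\<in>J. j \<in> I \<longleftrightarrow> j \<in> set_decode a}"

text \<open>Parameters outside the range of \<theta> on the indices always incur loss 1.\<close>

definition loss :: "nat \<Rightarrow> nat \<Rightarrow> 't \<Rightarrow> real" where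
  "loss t a \<theta>' = of_bool (\<not> (\<exists>I\<in>Pow J. \<theta>' = \<theta> I \<and> t \<le> hits I a))"

lemma finite_actions: "finite actions"
  using finJ by (simp add: actions_def)

lemma loss_problem: "decision_problem \<Theta> actions (loss t)"
  by (simp add: decision_problem_def finite_actions loss_def)

lemma loss_at:
  assumes "I \<subseteq> J"
  shows "loss t a (\<theta> I) = 1 - of_bool (t \<le> hits I a)"
proof -
  have "(\<exists>I'\<in>Pow J. \<theta> I = \<theta> I' \<and> t \<le> hits I' a) \<longleftrightarrow> t \<le> hits I a"
    using \<theta>_inj assms by (auto dest: inj_onD)
  then show ?thesis by (simp add: loss_def)
qed

text \<open>The success probability of action \<open>a\<close> under the posterior at
  \<open>x\<close>, up to normalisation.\<close>

definition score :: "nat \<Rightarrow> nat \<Rightarrow> nat \<Rightarrow> (nat \<Rightarrow> 'a) \<Rightarrow> real" where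
  "score t n a x = (\<Sum>I\<in>Pow J. of_bool (t \<le> hits I a) * (weight I n x / 2 ^ card J))"

text \<open>Replacing an index by the set of coordinates in which it agrees with the guess is an
  involution of \<open>Pow J\<close>; it turns the sum over indices into one over sets of correct
  coordinates.\<close>

lemma score_pbsum:
  "score t n a x = pbsum J (\<lambda>j. lik j (j \<in> set_decode a) n x / 2) (\<lambda>j. lik j (j \<notin> set_decode a) n x / 2)
     (\<lambda>k. of_bool (t \<le> k))"
proof -
  let ?D = "set_decode a"
  let ?r = "\<lambda>I. {j\<in>J. j \<in> I \<longleftrightarrow> j \<in> ?D}"
  let ?y = "\<lambda>j c. lik j c n x / 2"
  have "score t n a x = (\<Sum>C\<in>Pow J. (\<Prod>j\<in>J. if j \<in> C then ?y j (j \<in> ?D) else ?y j (j \<notin> ?D)) * of_bool (t \<le> card C))"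
    unfolding score_def
  proof (rule sum.reindex_bij_witness[where i = ?r and j = ?r])
    fix I assume "I \<in> Pow J"
    have "(\<Prod>j\<in>J. if j \<in> ?r I then ?y j (j \<in> ?D) else ?y j (j \<notin> ?D)) = (\<Prod>j\<in>J. ?y j (j \<in> I))"
      by (intro prod.cong refl) auto
    also have "\<dots> = weight I n x / 2 ^ card J"
      by (simp add: prod_dividef)
    finally show "(\<Prod>j\<in>J. if j \<in> ?r I then ?y j (j \<in> ?D) else ?y j (j \<notin> ?D)) * of_bool (t \<le> card (?r I))
        = of_bool (t \<le> hits I a) * (weight I n x / 2 ^ card J)"
      by (simp add: hits_def)
  qed auto
  then show ?thesis by (simp add: pbsum_prod_if[OF finJ])
qed

text \<open>A guess against the larger likelihood moves weight from success to failure.\<close>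

lemma score_le_best: "score t n a x \<le> best t n x"
  unfolding score_pbsum best_def
proof (rule pbsum_mono_weights[OF finJ])
  show "mono (\<lambda>k. of_bool (t \<le> k) :: real)"
    by (auto simp: mono_def)
  fix j
  show "0 \<le> lik j (j \<in> set_decode a) n x / 2 \<and>
      lik j (j \<in> set_decode a) n x / 2 \<le> half_max (lik j True n x) (lik j False n x) \<and>
      0 \<le> half_min (lik j True n x) (lik j False n x) \<and>
      lik j (j \<in> set_decode a) n x / 2 + lik j (j \<notin> set_decode a) n x / 2 =
      half_max (lik j True n x) (lik j False n x) + half_min (lik j True n x) (lik j False n x)"
    using lik_bounds(1)[of j _ n x] by (cases "j \<in> set_decode a") auto
qed

text \<open>Ties are resolved against membership; the score is unaffected, as the two likelihoods
  then coincide.\<close>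

definition guess :: "nat \<Rightarrow> (nat \<Rightarrow> 'a) \<Rightarrow> nat" where
  "guess n x = set_encode {j\<in>J. lik j False n x < lik j True n x}"

lemma decode_guess: "set_decode (guess n x) = {j\<in>J. lik j False n x < lik j True n x}"
  unfolding guess_def by (rule set_encode_inverse) (use finJ in auto)

lemma score_guess: "score t n (guess n x) x = best t n x"
  unfolding score_pbsum best_def decode_guess
proof (rule pbsum_cong)
  fix j assume "j \<in> J"
  then show "lik j (j \<in> {j\<in>J. lik j False n x < lik j True n x}) n x / 2
      = half_max (lik j True n x) (lik j False n x)"
    "lik j (j \<notin> {j\<in>J. lik j False n x < lik j True n x}) n x / 2
      = half_min (lik j True n x) (lik j False n x)"
    by (cases "lik j False n x < lik j True n x"; simp)+
qed

lemma sets_rep: "sets (rep_space n X) = sets (\<nu>n n)"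
  unfolding rep_space_def by (intro sets_PiM_cong) (simp_all add: sets_\<nu>)

lemma space_rep: "space (rep_space n X) = space (\<nu>n n)"
  by (rule sets_eq_imp_space_eq[OF sets_rep])

lemma guess_measurable: "guess n \<in> rep_space n X \<rightarrow>\<^sub>M count_space actions"
  unfolding measurable_count_space_eq2[OF finite_actions]
proof (intro conjI ballI funcsetI)
  show "guess n x \<in> actions" for x by (auto simp: guess_def actions_def)
  fix a assume "a \<in> actions"
  then obtain D where D: "D \<subseteq> J" "a = set_encode D" by (auto simp: actions_def)
  then have dec: "set_decode a = D" using finJ finite_subset by (metis set_encode_inverse)
  have "guess n x = a \<longleftrightarrow> (\<forall>j\<in>J. j \<in> D \<longleftrightarrow> lik j False n x < lik j True n x)" for x
  proof -
    have "guess n x = a \<longleftrightarrow> set_decode (guess n x) = D"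
      using dec by (metis set_decode_inverse)
    then show ?thesis using D(1) by (auto simp: decode_guess)
  qed
  then have "guess n -` {a} \<inter> space (rep_space n X)
      = {x \<in> space (\<nu>n n). \<forall>j\<in>J. j \<in> D \<longleftrightarrow> lik j False n x < lik j True n x}"
    by (auto simp: space_rep)
  also have "\<dots> \<in> sets (\<nu>n n)"
    using finJ by measurable
  finally show "guess n -` {a} \<inter> space (rep_space n X) \<in> sets (rep_space n X)"
    by (simp add: sets_rep)
qed

section \<open>Average success of randomised procedures\<close>

lemma procedures_eq:
  "decision_procedures (rep_space n X) A = \<nu>n n \<rightarrow>\<^sub>M prob_algebra (count_space A)"
  unfolding decision_procedures_def by (rule measurable_cong_sets[OF sets_rep refl])

lemma procedure_point:
  assumes \<rho>: "\<rho> \<in> decision_procedures (rep_space n X) actions" and x: "x \<in> space (\<nu>n n)"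
  shows "prob_space (\<rho> x)" "sets (\<rho> x) = Pow actions" "(\<Sum>a\<in>actions. measure (\<rho> x) {a}) = 1"
proof -
  have "\<rho> x \<in> space (prob_algebra (count_space actions))"
    using \<rho> x unfolding procedures_eq by (rule measurable_space)
  then show *: "prob_space (\<rho> x)" "sets (\<rho> x) = Pow actions"
    by (auto simp: space_prob_algebra)
  have "(\<integral>a. 1 \<partial>\<rho> x) = (\<Sum>a\<in>actions. 1 * measure (\<rho> x) {a})"
    using * by (intro integral_finite_discrete finite_actions) (auto simp: prob_space_def)
  then show "(\<Sum>a\<in>actions. measure (\<rho> x) {a}) = 1"
    using * by (simp add: prob_space.prob_space)
qed

lemma procedure_measurable:
  assumes \<rho>: "\<rho> \<in> decision_procedures (rep_space n X) actions" and a: "a \<in> actions"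
  shows "(\<lambda>x. measure (\<rho> x) {a}) \<in> borel_measurable (\<nu>n n)"
proof -
  have "(\<lambda>M. measure M {a}) \<in> borel_measurable (prob_algebra (count_space actions))"
    using a by (intro measurable_measure_prob_algebra) auto
  with \<rho> show ?thesis
    unfolding procedures_eq by (rule measurable_compose)
qed

lemma success_integrable:
  assumes \<rho>: "\<rho> \<in> decision_procedures (rep_space n X) actions"
  shows "integrable (\<nu>n n) (\<lambda>x. (\<Sum>a\<in>actions. of_bool (t \<le> hits I a) * measure (\<rho> x) {a}) * weight I n x)"
proof (rule integrable_weight_mult)
  show "(\<lambda>x. \<Sum>a\<in>actions. of_bool (t \<le> hits I a) * measure (\<rho> x) {a}) \<in> borel_measurable (\<nu>n n)"
    by (intro borel_measurable_sum borel_measurable_times borel_measurable_const procedure_measurable \<rho>)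
  fix x assume x: "x \<in> space (\<nu>n n)"
  have "(\<Sum>a\<in>actions. of_bool (t \<le> hits I a) * measure (\<rho> x) {a}) \<le> (\<Sum>a\<in>actions. measure (\<rho> x) {a})"
    by (intro sum_mono) simp
  moreover have "0 \<le> (\<Sum>a\<in>actions. of_bool (t \<le> hits I a) * measure (\<rho> x) {a})"
    by (intro sum_nonneg) simp
  ultimately show "\<bar>\<Sum>a\<in>actions. of_bool (t \<le> hits I a) * measure (\<rho> x) {a}\<bar> \<le> 1"
    using procedure_point(3)[OF \<rho> x] by simp
qed

lemma risk_at:
  assumes \<rho>: "\<rho> \<in> decision_procedures (rep_space n X) actions" and I: "I \<subseteq> J"
  shows "1 - risk (rep_family n P) (loss t) \<rho> (\<theta> I)
    = (\<integral>x. (\<Sum>a\<in>actions. of_bool (t \<le> hits I a) * measure (\<rho> x) {a}) * weight I n x \<partial>\<nu>n n)"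
proof -
  let ?s = "\<lambda>x. \<Sum>a\<in>actions. of_bool (t \<le> hits I a) * measure (\<rho> x) {a}"
  have meas: "?s \<in> borel_measurable (\<nu>n n)"
    by (intro borel_measurable_sum borel_measurable_times borel_measurable_const procedure_measurable \<rho>)
  have "(\<integral>a. loss t a (\<theta> I) \<partial>\<rho> x) = 1 - ?s x" if x: "x \<in> space (\<nu>n n)" for x
  proof -
    note pp = procedure_point[OF \<rho> x]
    have "(\<integral>a. loss t a (\<theta> I) \<partial>\<rho> x) = (\<Sum>a\<in>actions. loss t a (\<theta> I) * measure (\<rho> x) {a})"
      using pp by (intro integral_finite_discrete finite_actions) (auto simp: prob_space_def)
    also have "\<dots> = (\<Sum>a\<in>actions. measure (\<rho> x) {a}) - ?s x"
      by (simp add: loss_at[OF I] left_diff_distrib sum_subtractf)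
    finally show ?thesis using pp by simp
  qed
  then have "risk (rep_family n P) (loss t) \<rho> (\<theta> I) = (\<integral>x. 1 - ?s x \<partial>density (\<nu>n n) (\<lambda>x. ennreal (weight I n x)))"
    unfolding risk_def rep_density[OF I] by (intro Bochner_Integration.integral_cong) auto
  also have "\<dots> = (\<integral>x. weight I n x *\<^sub>R (1 - ?s x) \<partial>\<nu>n n)"
    by (rule integral_density[OF borel_measurable_diff[OF borel_measurable_const meas] weight_measurable])
      (simp add: weight_nonneg)
  also have "\<dots> = (\<integral>x. weight I n x - ?s x * weight I n x \<partial>\<nu>n n)"
    by (simp only: real_scaleR_def right_diff_distrib mult_1_right mult_1_left mult.commute)
  also have "\<dots> = 1 - (\<integral>x. ?s x * weight I n x \<partial>\<nu>n n)"
    by (subst Bochner_Integration.integral_diff[OF weight_integrable success_integrable[OF \<rho>]])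
       (simp add: weight_integral[OF I])
  finally show ?thesis by simp
qed

text \<open>Exchanging the sum over indices with the integral and the sum over actions collects the
  prior weights of all indices into the score.\<close>

lemma average_success:
  assumes \<rho>: "\<rho> \<in> decision_procedures (rep_space n X) actions"
  shows "(\<Sum>I\<in>Pow J. (1 - risk (rep_family n P) (loss t) \<rho> (\<theta> I)) / 2 ^ card J)
      = (\<integral>x. (\<Sum>a\<in>actions. measure (\<rho> x) {a} * score t n a x) \<partial>\<nu>n n)"
    and "integrable (\<nu>n n) (\<lambda>x. \<Sum>a\<in>actions. measure (\<rho> x) {a} * score t n a x)"
proof -
  let ?f = "\<lambda>I x. (\<Sum>a\<in>actions. of_bool (t \<le> hits I a) * measure (\<rho> x) {a}) * weight I n x"
  have eq: "(\<Sum>a\<in>actions. measure (\<rho> x) {a} * score t n a x) = (\<Sum>I\<in>Pow J. ?f I x / 2 ^ card J)" for x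
    unfolding score_def sum_distrib_left sum_distrib_right sum_divide_distrib
    by (subst sum.swap) (simp add: mult_ac)
  have int: "integrable (\<nu>n n) (\<lambda>x. ?f I x / 2 ^ card J)" for I
    by (intro integrable_divide success_integrable \<rho>)
  then show "integrable (\<nu>n n) (\<lambda>x. \<Sum>a\<in>actions. measure (\<rho> x) {a} * score t n a x)"
    unfolding eq by (intro Bochner_Integration.integrable_sum)
  have "(\<Sum>I\<in>Pow J. (1 - risk (rep_family n P) (loss t) \<rho> (\<theta> I)) / 2 ^ card J)
      = (\<Sum>I\<in>Pow J. (\<integral>x. ?f I x / 2 ^ card J \<partial>\<nu>n n))"
    by (intro sum.cong refl) (simp add: risk_at[OF \<rho>])
  also have "\<dots> = (\<integral>x. (\<Sum>a\<in>actions. measure (\<rho> x) {a} * score t n a x) \<partial>\<nu>n n)"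
    unfolding eq by (rule Bochner_Integration.integral_sum[symmetric]) (rule int)
  finally show "(\<Sum>I\<in>Pow J. (1 - risk (rep_family n P) (loss t) \<rho> (\<theta> I)) / 2 ^ card J)
      = (\<integral>x. (\<Sum>a\<in>actions. measure (\<rho> x) {a} * score t n a x) \<partial>\<nu>n n)" .
qed

lemma average_success_le:
  assumes \<rho>: "\<rho> \<in> decision_procedures (rep_space n X) actions"
  shows "(\<Sum>I\<in>Pow J. (1 - risk (rep_family n P) (loss t) \<rho> (\<theta> I)) / 2 ^ card J)
      \<le> (\<integral>x. best t n x \<partial>\<nu>n n)"
  unfolding average_success(1)[OF \<rho>]
proof (rule integral_mono[OF average_success(2)[OF \<rho>] best_integrable])
  fix x assume x: "x \<in> space (\<nu>n n)"
  have "(\<Sum>a\<in>actions. measure (\<rho> x) {a} * score t n a x) \<le> (\<Sum>a\<in>actions. measure (\<rho> x) {a} * best t n x)"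
    by (intro sum_mono mult_left_mono score_le_best) simp
  also have "\<dots> = best t n x"
    using procedure_point(3)[OF \<rho> x] by (simp add: sum_distrib_right[symmetric])
  finally show "(\<Sum>a\<in>actions. measure (\<rho> x) {a} * score t n a x) \<le> best t n x" .
qed

lemma average_success_attained:
  "\<exists>\<rho>\<in>decision_procedures (rep_space n X) actions.
    (\<Sum>I\<in>Pow J. (1 - risk (rep_family n P) (loss t) \<rho> (\<theta> I)) / 2 ^ card J) = (\<integral>x. best t n x \<partial>\<nu>n n)"
proof
  let ?\<rho> = "\<lambda>x. return (count_space actions) (guess n x)"
  have in_actions: "guess n x \<in> actions" for x by (auto simp: guess_def actions_def)
  show \<rho>: "?\<rho> \<in> decision_procedures (rep_space n X) actions"
    unfolding decision_procedures_def
    by (rule measurable_compose[OF guess_measurable measurable_return_prob_space])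
  have "(\<Sum>a\<in>actions. measure (?\<rho> x) {a} * score t n a x) = best t n x" for x
  proof -
    have "(\<Sum>a\<in>actions. measure (?\<rho> x) {a} * score t n a x)
        = (\<Sum>a\<in>actions. if a = guess n x then score t n a x else 0)"
      by (intro sum.cong refl) (simp add: measure_return indicator_def)
    also have "\<dots> = score t n (guess n x) x"
      using in_actions finite_actions by simp
    finally show ?thesis by (simp add: score_guess)
  qed
  then show "(\<Sum>I\<in>Pow J. (1 - risk (rep_family n P) (loss t) ?\<rho> (\<theta> I)) / 2 ^ card J) = (\<integral>x. best t n x \<partial>\<nu>n n)"
    unfolding average_success(1)[OF \<rho>] by simp
qed

text \<open>Averaging over the uniform prior: \<open>guess\<close> attains the Bayes success for
  \<open>n + 1\<close> observations, the procedure transferred to \<open>n\<close> observations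
  loses at most \<epsilon> at every index, and it cannot exceed the Bayes success for
  \<open>n\<close>.\<close>

lemma deficient_by_ge:
  assumes card: "card J = 2 * n" and n: "n \<ge> 1"
    and def: "deficient_by \<Theta> (rep_space n X) (rep_family n P) (rep_space (n + 1) X) (rep_family (n + 1) P) \<epsilon>"
  shows "b * (\<alpha>/2) * (real n / sqrt (18 * (real n + 1))) \<le> \<epsilon>"
proof (rule success_gain_ge[OF card n])
  fix t
  let ?avg = "\<lambda>n \<rho>. \<Sum>I\<in>Pow J. (1 - risk (rep_family n P) (loss t) \<rho> (\<theta> I)) / 2 ^ card J"
  obtain \<rho> where \<rho>: "\<rho> \<in> decision_procedures (rep_space (n + 1) X) actions"
      "?avg (n + 1) \<rho> = (\<integral>x. best t (n + 1) x \<partial>\<nu>n (n + 1))"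
    using average_success_attained by blast
  with def loss_problem[of t] obtain \<rho>' where \<rho>': "\<rho>' \<in> decision_procedures (rep_space n X) actions"
      "\<And>\<theta>'. \<theta>' \<in> \<Theta> \<Longrightarrow> risk (rep_family n P) (loss t) \<rho>' \<theta>' \<le> risk (rep_family (n + 1) P) (loss t) \<rho> \<theta>' + \<epsilon>"
    unfolding deficient_by_def by blast
  have "?avg (n + 1) \<rho> \<le> (\<Sum>I\<in>Pow J. (1 - risk (rep_family n P) (loss t) \<rho>' (\<theta> I)) / 2 ^ card J + \<epsilon> / 2 ^ card J)"
    using \<rho>'(2)[OF \<theta>_in] by (intro sum_mono) (force simp: add_divide_distrib[symmetric] intro!: divide_right_mono)
  also have "\<dots> = ?avg n \<rho>' + \<epsilon>"
    using finJ by (simp add: sum.distrib card_Pow)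
  finally have "(\<integral>x. best t (Suc n) x \<partial>\<nu>n (Suc n)) \<le> (\<integral>x. best t n x \<partial>\<nu>n n) + \<epsilon>"
    using average_success_le[OF \<rho>'(1), of t] \<rho>(2) by simp
  then show "E (Suc n) (\<lambda>N. correct J N (\<lambda>k. of_bool (t \<le> k))) (\<lambda>_. 0)
      \<le> E n (\<lambda>N. correct J N (\<lambda>k. of_bool (t \<le> k))) (\<lambda>_. 0) + \<epsilon>"
    by (simp only: best_integral)
qed

end

section \<open>Rich families\<close>

lemma (in prob_space) prob_Int_full:
  assumes "A \<in> events" "B \<in> events" "prob A = 1"
  shows "prob (B \<inter> A) = prob B"
  using AE_prob_1[OF assms(3)] assms(1,2) by (intro finite_measure_eq_AE) auto

lemma (in prob_space) measure_density_real:
  assumes g[measurable]: "g \<in> borel_measurable M" and nn: "\<And>x. 0 \<le> g x"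
    and B[measurable]: "B \<in> sets M"
  shows "measure (density M (\<lambda>x. ennreal (g x))) B = (\<integral>x. indicator B x * g x \<partial>M)"
proof -
  have "measure (density M (\<lambda>x. ennreal (g x))) B = (\<integral>x. indicator B x \<partial>density M (\<lambda>x. ennreal (g x)))"
    using sets.sets_into_space[OF B] by (simp add: Int_absorb1 Int_absorb2)
  also have "\<dots> = (\<integral>x. g x *\<^sub>R indicator B x \<partial>M)"
    by (rule integral_density) (use nn in auto)
  finally show ?thesis by (simp add: mult.commute)
qed

text \<open>With respect to the midpoint of the two measures their densities add up to 2 almost
  everywhere, so they lie symmetrically about 1.\<close>

lemma common_signed_density:
  assumes P0: "prob_space P0" "sets P0 = sets X" and P1: "prob_space P1" "sets P1 = sets X"
  obtains \<nu> h where "prob_space \<nu>" "sets \<nu> = sets X" "h \<in> borel_measurable \<nu>" "\<And>x. \<bar>h x :: real\<bar> \<le> 1"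
    "P1 = density \<nu> (\<lambda>x. ennreal (1 + h x))" "P0 = density \<nu> (\<lambda>x. ennreal (1 - h x))"
proof -
  interpret P0: prob_space P0 by (rule P0(1))
  interpret P1: prob_space P1 by (rule P1(1))
  define M where "M = measure_pmf (bernoulli_pmf (1/2))"
  define f where "f c = (if c then P1 else P0)" for c
  have f: "f \<in> M \<rightarrow>\<^sub>M prob_algebra X"
    using P0 P1 by (auto simp: M_def f_def measurable_def space_prob_algebra)
  \<comment> \<open>The midpoint, obtained as the mixture of both measures by a fair coin.\<close>
  define \<nu> where "\<nu> = M \<bind> f"
  have f': "f \<in> M \<rightarrow>\<^sub>M subprob_algebra X" by (rule measurable_prob_algebraD[OF f])
  have sets: "sets \<nu> = sets X"
    unfolding \<nu>_def by (rule sets_bind[OF _ ]) (use P0 P1 in \<open>auto simp: M_def f_def\<close>)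
  have em: "emeasure \<nu> B = (emeasure P1 B + emeasure P0 B) / 2" if "B \<in> sets X" for B
  proof -
    have "emeasure \<nu> B = (\<integral>\<^sup>+c. emeasure (f c) B \<partial>M)"
      unfolding \<nu>_def by (rule emeasure_bind[OF _ f' that]) (simp add: M_def)
    also have "\<dots> = emeasure P1 B * inverse 2 + emeasure P0 B * inverse 2"
      by (simp add: M_def f_def)
    also have "\<dots> = (emeasure P1 B + emeasure P0 B) / 2"
      by (simp only: divide_ennreal_def distrib_right)
    finally show ?thesis .
  qed
  have double: "2 * emeasure \<nu> B = emeasure P1 B + emeasure P0 B" if "B \<in> sets X" for B
    unfolding em[OF that] ennreal_times_divide
    by (subst mult.commute) (rule mult_divide_eq_ennreal; simp)
  have "prob_space \<nu>"
  proof
    have "space \<nu> = space P1" "space \<nu> = space P0"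
      using sets P0 P1 by (auto intro!: sets_eq_imp_space_eq)
    then have "emeasure \<nu> (space \<nu>) = (1 + 1) / 2"
      using em[of "space \<nu>"] sets by (metis P0.emeasure_space_1 P1.emeasure_space_1 sets.top)
    then show "emeasure \<nu> (space \<nu>) = 1"
      by simp
  qed
  then interpret \<nu>: prob_space \<nu> .
  define f1 where "f1 = RN_deriv \<nu> P1"
  define f0 where "f0 = RN_deriv \<nu> P0"
  have "absolutely_continuous \<nu> P1" "absolutely_continuous \<nu> P0"
    using double sets P0(2) P1(2)
    by (auto simp: absolutely_continuous_def null_sets_def) (metis add_eq_0_iff_both_eq_0 mult_zero_right)+
  then have d1: "density \<nu> f1 = P1" and d0: "density \<nu> f0 = P0"
    unfolding f1_def f0_def using sets P0(2) P1(2) by (auto intro!: \<nu>.density_RN_deriv)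
  have [measurable]: "f1 \<in> borel_measurable \<nu>" "f0 \<in> borel_measurable \<nu>"
    by (auto simp: f1_def f0_def)
  have "density \<nu> (\<lambda>x. f1 x + f0 x) = density \<nu> (\<lambda>_. 2)"
  proof (rule measure_eqI)
    fix B assume "B \<in> Sigma_Algebra.sets (density \<nu> (\<lambda>x. f1 x + f0 x))"
    then have B [measurable]: "B \<in> Sigma_Algebra.sets \<nu>" by simp
    have "emeasure (density \<nu> (\<lambda>x. f1 x + f0 x)) B = emeasure (density \<nu> f1) B + emeasure (density \<nu> f0) B"
      by (simp add: emeasure_density nn_integral_add distrib_right)
    also have "\<dots> = 2 * emeasure \<nu> B"
      using double[of B] B sets by (simp add: d1 d0)
    finally show "emeasure (density \<nu> (\<lambda>x. f1 x + f0 x)) B = emeasure (density \<nu> (\<lambda>_. 2)) B"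
      by (simp add: emeasure_density nn_integral_cmult)
  qed simp
  then have sum2: "AE x in \<nu>. f1 x + f0 x = 2"
    by (intro \<nu>.density_unique) auto
  \<comment> \<open>The minimum enforces the bound on \<open>h\<close> everywhere and not only
    almost everywhere.\<close>
  define h where "h x = min 1 (enn2real (f1 x) - 1)" for x
  have h: "f1 x = ennreal (1 + h x) \<and> f0 x = ennreal (1 - h x)" if eq: "f1 x + f0 x = 2" for x
  proof -
    obtain r s where rs: "f1 x = ennreal r" "f0 x = ennreal s" "0 \<le> r" "0 \<le> s"
      using eq by (cases "f1 x"; cases "f0 x") (auto simp: top_unique)
    then have "ennreal (r + s) = ennreal 2" using eq by simp
    then have "r + s = 2" using rs by (subst (asm) ennreal_inj) auto
    then show ?thesis using rs by (simp add: h_def)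
  qed
  have [measurable]: "h \<in> borel_measurable \<nu>" unfolding h_def by measurable
  show thesis
  proof
    show "prob_space \<nu>" "sets \<nu> = sets X" "h \<in> borel_measurable \<nu>" by fact+
    show "\<bar>h x\<bar> \<le> 1" for x
      using enn2real_nonneg[of "f1 x"] unfolding h_def by linarith
    have "density \<nu> f1 = density \<nu> (\<lambda>x. ennreal (1 + h x))" "density \<nu> f0 = density \<nu> (\<lambda>x. ennreal (1 - h x))"
      by (rule density_cong; use sum2 h in auto)+
    then show "P1 = density \<nu> (\<lambda>x. ennreal (1 + h x))" "P0 = density \<nu> (\<lambda>x. ennreal (1 - h x))"
      using d1 d0 by auto
  qed
qed

text \<open>The extreme indices \<open>J\<close> and \<open>{}\<close> determine \<nu> and
  \<open>h\<close>. Every component lives on its own cell, so on \<open>S j\<close> each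
  \<open>P (\<theta> I)\<close> coincides with one of the two extremes, and this determines its
  density.\<close>

lemma rich_signed_experiment:
  fixes P :: "'t \<Rightarrow> 'a measure"
  assumes exp: "is_experiment \<Theta> X P" and m: "m \<ge> 1" and \<alpha>: "\<alpha> > 0" and \<beta>: "\<beta> > 0"
    and rich: "rich m \<alpha> \<beta> \<Theta> X P"
  obtains \<nu> S h \<theta> where "signed_experiment \<nu> {1..m} S h (\<beta> / real m) \<alpha> \<Theta> X P \<theta>"
proof -
  define J where "J = {1..m}"
  define b where "b = \<beta> / real m"
  have b: "b > 0" using \<beta> m by (simp add: b_def)
  obtain S p and Q :: "nat \<Rightarrow> nat \<Rightarrow> 'a measure" where
    S1: "\<forall>j\<in>J. S j \<in> sets X" and S23: "disjoint_family_on S J" "(\<Union>j\<in>J. S j) = space X"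
    and p': "\<forall>j\<in>J. b \<le> p j"
    and Q': "\<forall>j\<in>J. \<forall>k\<in>{0, 1}. Q j k \<in> space (prob_algebra X) \<and> measure (Q j k) (S j) = 1"
    and tv': "\<forall>j\<in>J. Q j 0 \<noteq> Q j 1 \<and> \<alpha> \<le> tv_dist (Q j 0) (Q j 1)"
    and mix: "\<forall>i\<in>J \<rightarrow> {0, 1}. \<exists>\<theta>\<in>\<Theta>. \<forall>B\<in>sets X.
        measure (P \<theta>) B = (\<Sum>j\<in>J. p j * measure (Q j (i j)) B)"
    using rich unfolding rich_def J_def[symmetric] b_def[symmetric]
    by (elim exE conjE) (rule that; assumption)
  have S: "\<And>j. j \<in> J \<Longrightarrow> S j \<in> sets X" "disjoint_family_on S J" "(\<Union>j\<in>J. S j) = space X"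
    and p: "\<And>j. j \<in> J \<Longrightarrow> b \<le> p j"
    and Q: "\<And>j k. j \<in> J \<Longrightarrow> k \<in> {0, 1} \<Longrightarrow> Q j k \<in> space (prob_algebra X) \<and> measure (Q j k) (S j) = 1"
    and tv: "\<And>j. j \<in> J \<Longrightarrow> \<alpha> \<le> tv_dist (Q j 0) (Q j 1)"
    using S1 S23 p' Q' tv' by auto
  have finJ: "finite J" by (simp add: J_def)
  have p_pos: "p j > 0" if "j \<in> J" for j using p[OF that] b by linarith
  \<comment> \<open>Membership in \<open>I\<close> selects \<open>Q j 0\<close>, which thereby
    belongs to the density \<open>1 + h\<close>.\<close>
  define k :: "nat set \<Rightarrow> nat \<Rightarrow> nat" where "k I j = of_bool (j \<notin> I)" for I j
  have k01: "k I j \<in> {0, 1}" for I j by (simp add: k_def)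
  have "\<exists>\<theta>. \<theta> \<in> \<Theta> \<and> (\<forall>B\<in>sets X. measure (P \<theta>) B = (\<Sum>j\<in>J. p j * measure (Q j (k I j)) B))" for I
    using mix k01 by blast
  then obtain \<theta> where \<theta>: "\<And>I. \<theta> I \<in> \<Theta>"
    and P: "\<And>I B. B \<in> sets X \<Longrightarrow> measure (P (\<theta> I)) B = (\<Sum>j\<in>J. p j * measure (Q j (k I j)) B)"
    by metis
  have P_prob: "prob_space (P (\<theta> I))" and P_sets: "sets (P (\<theta> I)) = sets X" for I
    using exp \<theta>[of I] by (auto simp: is_experiment_def space_prob_algebra)
  have Q_prob: "prob_space (Q j c)" and Q_sets: "sets (Q j c) = sets X" and Q_S: "measure (Q j c) (S j) = 1"
    if "j \<in> J" "c \<in> {0, 1}" for j c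
    using Q[OF that] by (auto simp: space_prob_algebra)
  have cell: "measure (P (\<theta> I)) (B \<inter> S j) = p j * measure (Q j (k I j)) B"
    if j: "j \<in> J" and B: "B \<in> sets X" for I j B
  proof -
    have full: "measure (Q i (k I i)) (A \<inter> S i) = measure (Q i (k I i)) A" if "i \<in> J" "A \<in> sets X" for i A
      using that S(1)[of i] Q_prob[OF _ k01] Q_sets[OF _ k01] Q_S[OF _ k01] by (intro prob_space.prob_Int_full) auto
    have "measure (Q i (k I i)) (B \<inter> S j) = 0" if "i \<in> J" "i \<noteq> j" for i
    proof -
      have "B \<inter> S j \<inter> S i = {}" using S(2) that j by (auto simp: disjoint_family_on_def)
      then show ?thesis using full[OF that(1), of "B \<inter> S j"] B S(1)[OF j] by auto
    qed
    then have "(\<Sum>i\<in>J. p i * measure (Q i (k I i)) (B \<inter> S j))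
        = (\<Sum>i\<in>J. if i = j then p i * measure (Q i (k I i)) (B \<inter> S j) else 0)"
      by (intro sum.cong) auto
    also have "\<dots> = p j * measure (Q j (k I j)) B"
      using j finJ full[OF j B] by simp
    finally show ?thesis using P B S(1)[OF j] by simp
  qed
  have P_S: "measure (P (\<theta> I)) (S j) = p j" if j: "j \<in> J" for I j
  proof -
    have "S j \<inter> S j = S j" by simp
    then show ?thesis using cell[OF j S(1)[OF j], of I] Q_S[OF j k01] by simp
  qed
  obtain \<nu> h where \<nu>: "prob_space \<nu>" "sets \<nu> = sets X" and h: "h \<in> borel_measurable \<nu>" "\<And>x. \<bar>h x :: real\<bar> \<le> 1"
    and P1: "P (\<theta> J) = density \<nu> (\<lambda>x. ennreal (1 + h x))"
    and P0: "P (\<theta> {}) = density \<nu> (\<lambda>x. ennreal (1 - h x))"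
    by (rule common_signed_density[where ?P0.0 = "P (\<theta> {})" and ?P1.0 = "P (\<theta> J)", OF P_prob P_sets P_prob P_sets], rule that)
  interpret \<nu>: prob_space \<nu> by (rule \<nu>(1))
  have hb: "0 \<le> 1 + h x" "0 \<le> 1 - h x" for x using h(2)[of x] by (auto simp: abs_le_iff)
  note [measurable] = h(1)
  have ind_int: "integrable \<nu> (\<lambda>x. indicator B x * h x)" "integrable \<nu> (\<lambda>x. indicator B x * \<bar>h x\<bar>)"
      "integrable \<nu> (indicator B :: 'a \<Rightarrow> real)"
    if [measurable]: "B \<in> sets \<nu>" for B
    by (rule \<nu>.integrable_const_bound[where B = 1]; use h(2) in \<open>auto simp: indicator_def\<close>)+
  have P1': "measure (P (\<theta> J)) B = measure \<nu> B + (\<integral>x. indicator B x * h x \<partial>\<nu>)"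
    and P0': "measure (P (\<theta> {})) B = measure \<nu> B - (\<integral>x. indicator B x * h x \<partial>\<nu>)"
    if B: "B \<in> sets \<nu>" for B
  proof -
    have "measure (P (\<theta> J)) B = (\<integral>x. indicator B x * (1 + h x) \<partial>\<nu>)"
      unfolding P1 by (rule \<nu>.measure_density_real) (use hb B in auto)
    then show "measure (P (\<theta> J)) B = measure \<nu> B + (\<integral>x. indicator B x * h x \<partial>\<nu>)"
      using ind_int[OF B] sets.sets_into_space[OF B] by (simp add: distrib_left Int_absorb1 Int_absorb2)
    have "measure (P (\<theta> {})) B = (\<integral>x. indicator B x * (1 - h x) \<partial>\<nu>)"
      unfolding P0 by (rule \<nu>.measure_density_real) (use hb B in auto)
    then show "measure (P (\<theta> {})) B = measure \<nu> B - (\<integral>x. indicator B x * h x \<partial>\<nu>)"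
      using ind_int[OF B] sets.sets_into_space[OF B] by (simp add: right_diff_distrib Int_absorb1 Int_absorb2)
  qed
  have S\<nu>: "S j \<in> sets \<nu>" if "j \<in> J" for j using S(1)[OF that] \<nu>(2) by simp
  \<comment> \<open>Both extremes give \<open>S j\<close> the mass \<open>p j\<close>; the sum and
    the difference of the two formulas yield the claims.\<close>
  have \<nu>_S: "measure \<nu> (S j) = p j" and mean: "(\<integral>x. indicator (S j) x * h x \<partial>\<nu>) = 0" if j: "j \<in> J" for j
    using P1'[OF S\<nu>[OF j]] P0'[OF S\<nu>[OF j]] P_S[OF j] by auto
  have abs: "\<alpha> * measure \<nu> (S j) \<le> (\<integral>x. indicator (S j) x * \<bar>h x\<bar> \<partial>\<nu>)" if j: "j \<in> J" for j
  proof -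
    let ?I = "\<integral>x. indicator (S j) x * \<bar>h x\<bar> \<partial>\<nu>"
    have "\<bar>measure (Q j 0) B - measure (Q j 1) B\<bar> \<le> ?I / p j" if "B \<in> sets (Q j 0)" for B
    proof -
      have B: "B \<in> sets X" using that Q_sets[OF j] by simp
      then have BS: "B \<inter> S j \<in> sets \<nu>" using S\<nu>[OF j] \<nu>(2) by auto
      have kk: "k J j = 0" "k {} j = 1" using j by (auto simp: k_def)
      have "p j * (measure (Q j 0) B - measure (Q j 1) B) = 2 * (\<integral>x. indicator (B \<inter> S j) x * h x \<partial>\<nu>)"
        using cell[OF j B, of J] cell[OF j B, of "{}"] P1'[OF BS] P0'[OF BS] unfolding kk
        by (simp add: right_diff_distrib)
      \<comment> \<open>Subtracting the vanishing mean makes the integrand \<open>h\<close> or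
        \<open>-h\<close> on \<open>S j\<close>, so its absolute value integrates to
        \<open>?I\<close> without a lost factor 2.\<close>
      also have "\<dots> = 2 * (\<integral>x. indicator (B \<inter> S j) x * h x \<partial>\<nu>) - (\<integral>x. indicator (S j) x * h x \<partial>\<nu>)"
        by (simp add: mean[OF j])
      also have "\<dots> = (\<integral>x. 2 * (indicator (B \<inter> S j) x * h x) - indicator (S j) x * h x \<partial>\<nu>)"
        using ind_int[OF BS] ind_int[OF S\<nu>[OF j]] by simp
      finally have eq: "p j * (measure (Q j 0) B - measure (Q j 1) B)
          = (\<integral>x. 2 * (indicator (B \<inter> S j) x * h x) - indicator (S j) x * h x \<partial>\<nu>)" .
      have "\<bar>\<integral>x. 2 * (indicator (B \<inter> S j) x * h x) - indicator (S j) x * h x \<partial>\<nu>\<bar>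
          \<le> (\<integral>x. \<bar>2 * (indicator (B \<inter> S j) x * h x) - indicator (S j) x * h x\<bar> \<partial>\<nu>)"
        by (rule integral_abs_bound)
      also have "\<dots> = ?I"
        by (intro Bochner_Integration.integral_cong) (auto simp: indicator_def)
      finally have "p j * \<bar>measure (Q j 0) B - measure (Q j 1) B\<bar> \<le> ?I"
        unfolding eq[symmetric] using p_pos[OF j] by (simp add: abs_mult)
      then show ?thesis using p_pos[OF j] by (simp add: pos_le_divide_eq mult.commute)
    qed
    then have "tv_dist (Q j 0) (Q j 1) \<le> ?I / p j"
      unfolding tv_dist_def by (intro cSUP_least) (auto intro: sets.top)
    with tv[OF j] have "\<alpha> \<le> ?I / p j" by linarith
    then show ?thesis using p_pos[OF j] by (simp add: \<nu>_S[OF j] pos_le_divide_eq)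
  qed
  \<comment> \<open>Equal parameters for indices that differ at \<open>j\<close> would make
    \<open>Q j 0\<close> and \<open>Q j 1\<close> agree on all events, against their distance of at
    least \<alpha>.\<close>
  have inj: "inj_on \<theta> (Pow J)"
  proof (rule inj_onI, rule ccontr)
    fix I I' assume I: "I \<in> Pow J" "I' \<in> Pow J" and eq: "\<theta> I = \<theta> I'" and "I \<noteq> I'"
    then obtain j where "j \<in> J" "(j \<in> I) \<noteq> (j \<in> I')" by blast
    then have j: "j \<in> J" "k I j \<noteq> k I' j" by (auto simp: k_def)
    have same: "measure (Q j (k I j)) B = measure (Q j (k I' j)) B" if "B \<in> sets X" for B
      using cell[OF j(1) that, of I] cell[OF j(1) that, of I'] p_pos[OF j(1)] by (simp add: eq)
    have "measure (Q j 0) B = measure (Q j 1) B" if "B \<in> sets X" for B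
      using same[OF that] j(2) k01[of I j] k01[of I' j] by auto
    then have "tv_dist (Q j 0) (Q j 1) \<le> 0"
      unfolding tv_dist_def using Q_sets[OF j(1)] by (intro cSUP_least) (auto intro: sets.top)
    with tv[OF j(1)] \<alpha> show False by linarith
  qed
  interpret sc: signed_cells \<nu> J S h b \<alpha>
  proof
    show "(\<Union>j\<in>J. S j) = space \<nu>" using S(3) sets_eq_imp_space_eq[OF \<nu>(2)] by simp
    show "b \<le> measure \<nu> (S j)" if "j \<in> J" for j using p[OF that] \<nu>_S[OF that] by simp
  qed (use finJ S\<nu> S(2) h b \<alpha> mean abs in auto)
  have dens: "P (\<theta> I) = density \<nu> (\<lambda>y. ennreal (\<Prod>j\<in>J. sc.factor j (j \<in> I) y))" if I: "I \<subseteq> J" for I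
  proof (rule measure_eqI)
    interpret PI: prob_space "P (\<theta> I)" by (rule P_prob)
    let ?g = "\<lambda>j y. ennreal (if j \<in> I then 1 + h y else 1 - h y)"
    fix B assume "B \<in> sets (P (\<theta> I))"
    then have B: "B \<in> sets X" and [measurable]: "B \<in> sets \<nu>" using P_sets \<nu>(2) by auto
    have BS: "B \<inter> S j \<in> sets \<nu>" if "j \<in> J" for j using S\<nu>[OF that] by auto
    have "emeasure (P (\<theta> I)) B = emeasure (P (\<theta> I)) (\<Union>j\<in>J. B \<inter> S j)"
      using sets.sets_into_space[OF B] S(3) by (intro arg_cong[where f = "emeasure _"]) auto
    also have "\<dots> = (\<Sum>j\<in>J. emeasure (P (\<theta> I)) (B \<inter> S j))"
      using finJ BS S(2) P_sets \<nu>(2)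
      by (intro sum_emeasure[symmetric]) (auto simp: disjoint_family_on_def)
    also have "\<dots> = (\<Sum>j\<in>J. \<integral>\<^sup>+y. ?g j y * indicator (B \<inter> S j) y \<partial>\<nu>)"
    proof (rule sum.cong[OF refl])
      fix j assume j: "j \<in> J"
      \<comment> \<open>The extreme index that agrees with \<open>I\<close> at
        \<open>j\<close>.\<close>
      let ?K = "if j \<in> I then J else {}"
      interpret PK: prob_space "P (\<theta> ?K)" by (rule P_prob)
      have "k I j = k ?K j" using j by (simp add: k_def)
      then have "emeasure (P (\<theta> I)) (B \<inter> S j) = emeasure (P (\<theta> ?K)) (B \<inter> S j)"
        using cell[OF j B] by (simp add: PI.emeasure_eq_measure PK.emeasure_eq_measure)
      also have "\<dots> = (\<integral>\<^sup>+y. ?g j y * indicator (B \<inter> S j) y \<partial>\<nu>)"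
        using BS[OF j] by (cases "j \<in> I") (simp_all add: P1 P0 emeasure_density)
      finally show "emeasure (P (\<theta> I)) (B \<inter> S j) = (\<integral>\<^sup>+y. ?g j y * indicator (B \<inter> S j) y \<partial>\<nu>)" .
    qed
    also have "\<dots> = (\<integral>\<^sup>+y. (\<Sum>j\<in>J. ?g j y * indicator (B \<inter> S j) y) \<partial>\<nu>)"
      using BS by (subst nn_integral_sum) auto
    also have "\<dots> = (\<integral>\<^sup>+y. ennreal (\<Prod>j\<in>J. sc.factor j (j \<in> I) y) * indicator B y \<partial>\<nu>)"
    proof (rule nn_integral_cong)
      fix y assume "y \<in> space \<nu>"
      then obtain i where i: "i \<in> J" "y \<in> S i" using sc.cover by blast
      have other: "y \<notin> S j" if "j \<in> J" "j \<noteq> i" for j using sc.cell_unique i that by blast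
      have "(\<Sum>j\<in>J. ?g j y * indicator (B \<inter> S j) y) = (\<Sum>j\<in>J. if j = i then ?g j y * indicator B y else 0)"
        using i other by (intro sum.cong) (auto simp: indicator_def)
      moreover have "(\<Prod>j\<in>J. sc.factor j (j \<in> I) y) = (\<Prod>j\<in>J. if j = i then (if j \<in> I then 1 + h y else 1 - h y) else 1)"
        using i other by (intro prod.cong) (auto simp: sc.factor_def)
      ultimately show "(\<Sum>j\<in>J. ?g j y * indicator (B \<inter> S j) y) = ennreal (\<Prod>j\<in>J. sc.factor j (j \<in> I) y) * indicator B y"
        using i finJ by simp
    qed
    also have "\<dots> = emeasure (density \<nu> (\<lambda>y. ennreal (\<Prod>j\<in>J. sc.factor j (j \<in> I) y))) B"
      by (simp add: emeasure_density)
    finally show "emeasure (P (\<theta> I)) B = emeasure (density \<nu> (\<lambda>y. ennreal (\<Prod>j\<in>J. sc.factor j (j \<in> I) y))) B" .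
  qed (simp add: P_sets \<nu>(2))
  have "signed_experiment \<nu> J S h b \<alpha> \<Theta> X P \<theta>"
    by (intro signed_experiment.intro sc.signed_cells_axioms signed_experiment_axioms.intro
        \<nu>(2) \<theta> inj dens P_prob)
  then show thesis using that unfolding J_def b_def by blast
qed

lemma is_experiment_rep:
  assumes "is_experiment \<Theta> X P"
  shows "is_experiment \<Theta> (rep_space n X) (rep_family n P)"
  using assms unfolding is_experiment_def rep_space_def rep_family_def
  by (auto simp: space_prob_algebra intro!: prob_space_PiM sets_PiM_cong)

theorem theorem2:
  fixes \<Theta> :: "'t set" and X :: "'a measure" and P :: "'t \<Rightarrow> 'a measure"
    and n :: nat and \<alpha> \<beta> :: real
  assumes "is_experiment \<Theta> X P"
    and "n \<ge> 1" and "\<alpha> > 0" and "\<beta> > 0"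
    and "rich (2 * n) \<alpha> \<beta> \<Theta> X P"
  shows "\<alpha> * \<beta> / (12 * sqrt 2) * (1 / sqrt (real (n + 1)))
    \<le> deficiency \<Theta> (rep_space n X) (rep_family n P) (rep_space (n + 1) X) (rep_family (n + 1) P)"
proof -
  obtain \<nu> S h \<theta> where "signed_experiment \<nu> {1..2 * n} S h (\<beta> / real (2 * n)) \<alpha> \<Theta> X P \<theta>"
    by (rule rich_signed_experiment[OF assms(1) _ assms(3-5)]) (use assms(2) in auto)
  then interpret se: signed_experiment \<nu> "{1..2 * n}" S h "\<beta> / real (2 * n)" \<alpha> \<Theta> X P \<theta> .
  have "sqrt 18 = sqrt (3\<^sup>2 * 2)" by simp
  then have sqrt18: "sqrt 18 = 3 * sqrt 2" by (simp only: real_sqrt_mult real_sqrt_abs abs_numeral)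
  have "sqrt (18 * (real n + 1)) = 3 * sqrt 2 * sqrt (real (n + 1))"
    by (simp only: real_sqrt_mult sqrt18 of_nat_add of_nat_1)
  \<comment> \<open>The factor \<open>n\<close> of the pivotal mass cancels against the lower bound
    \<open>\<beta> / (2 * n)\<close> on the cell masses.\<close>
  moreover have "\<alpha> * \<beta> / (12 * s) * (1 / r) = \<beta> / real (2 * n) * (\<alpha>/2) * (real n / (3 * s * r))" for s r
    using assms(2) by (simp add: mult_ac)
  ultimately have const: "\<alpha> * \<beta> / (12 * sqrt 2) * (1 / sqrt (real (n + 1)))
      = \<beta> / real (2 * n) * (\<alpha>/2) * (real n / sqrt (18 * (real n + 1)))"
    by presburger
  show ?thesis
    unfolding deficiency_def
  proof (rule cInf_greatest)
    \<comment> \<open>The bound on the infimum requires a nonempty set; an index provides a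
      parameter, which makes 1 admissible.\<close>
    have "\<Theta> \<noteq> {}" using se.\<theta>_in[of "{}"] by auto
    then have "deficient_by \<Theta> (rep_space n X) (rep_family n P) (rep_space (n + 1) X) (rep_family (n + 1) P) 1"
      by (intro deficient_by_1 is_experiment_rep assms(1))
    then show "{\<epsilon>. 0 \<le> \<epsilon> \<and> deficient_by \<Theta> (rep_space n X) (rep_family n P)
        (rep_space (n + 1) X) (rep_family (n + 1) P) \<epsilon>} \<noteq> {}"
      by (auto intro!: exI[of _ 1])
    fix \<epsilon> assume "\<epsilon> \<in> {\<epsilon>. 0 \<le> \<epsilon> \<and> deficient_by \<Theta> (rep_space n X) (rep_family n P)
        (rep_space (n + 1) X) (rep_family (n + 1) P) \<epsilon>}"
    then show "\<alpha> * \<beta> / (12 * sqrt 2) * (1 / sqrt (real (n + 1))) \<le> \<epsilon>"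
      unfolding const using assms(2) by (intro se.deficient_by_ge) auto
  qed
qed

end
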